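(* Let $n\ge 3$, let $\Bbbk$ be a field of characteristic zero, let $S=\Bbbk[x_1,\ldots,x_n]$ with the standard grading, and let $\ell=x_1+\cdots+x_n$. Let $d\ge 2$. For an artinian monomial ideal $I\subset S$ generated in degree $d$ put $R=S/I$ and $\mathrm{HF}(R,d)=\dim_\Bbbk R_d$. (i) If $I\subset S$ is an artinian monomial ideal generated in degree $d$ such that $R=S/I$ fails the Strong Lefschetz property, then $$\mathrm{HF}(R,d)\ \ge\ \begin{cases}4 & \text{if } d=2,\\ 3 & \text{if } d\ge 3.\end{cases}$$ Moreover, this is sharp: for every $d\ge 2$, with $(n,d)\neq(3,2)$, there is an artinian monomial ideal $I\subset S$ generated in degree $d$ such that the multiplication map $\ell^{d-1}:R_1\to R_d$ is not surjective and $\mathrm{HF}(R,d)$ equals this bound. (ii) Let $1\le i\le d-1$. If $I\subset S$ is an artinian monomial ideal generated in degree $d$ such that multiplication by $\ell^i$ on $R=S/I$ fails to have maximal rank in some degree (that is, for some $j\ge 0$ the map $\ell^i:R_j\to R_{j+i}$ is neither injective nor surjective), then $$\mathrm{HF}(R,d)\ \ge\ d-i+2.$$ Moreover, the bound is sharp for every $2\le i\le d-1$: for each such $i$ there is an artinian monomial ideal $I\subset S$ generated in degree $d$ such that $\ell^i:R_{d-i}\to R_d$ is not surjective and $\mathrm{HF}(R,d)=d-i+2$.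
   Context: A monomial ideal is generated in degree $d$ if all its minimal monomial generators have degree $d$. An ideal $I$ is artinian if $S/I$ is a finite-dimensional $\Bbbk$-vector space. $R_j$ denotes the degree $j$ graded piece of $R$. An artinian graded algebra $R$ has the Strong Lefschetz property (SLP) if there is a linear form $\ell'\in R_1$ such that for all $i\ge 1$ and all $j\geq 0$ the multiplication map $\ell'^{\,i}:R_j\to R_{j+i}$ has maximal rank, i.e. is injective or surjective; otherwise $R$ fails the SLP. *)

theory Defs
  imports
    "HOL-Library.Poly_Mapping"
    "HOL-Library.Cardinality"
    "HOL-Algebra.QuotRing"
    "HOL-Algebra.Embedded_Algebras"
begin

text \<open>
  Polynomials over \<open>'k\<close> in the variables \<open>x\<^sub>v\<close>, where \<open>v\<close> ranges over the finite type \<open>'n\<close>, are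
  finitely supported maps from exponent vectors to coefficients; multiplication on this type is
  convolution. So the number of variables is \<open>CARD('n)\<close>.
\<close>

type_synonym ('n, 'k) mpoly = "('n \<Rightarrow>\<^sub>0 nat) \<Rightarrow>\<^sub>0 'k"

definition mpoly_ring :: "('n::finite, 'k::field) mpoly ring" where
  "mpoly_ring = \<lparr>carrier = UNIV, mult = (*), one = 1, zero = 0, add = (+)\<rparr>"

lemma cring_mpoly_ring: "cring (mpoly_ring :: ('n::finite, 'k::field) mpoly ring)"
proof (rule cringI)
  show "abelian_group (mpoly_ring :: ('n, 'k) mpoly ring)"
  proof (rule abelian_groupI)
    fix x :: "('n, 'k) mpoly"
    show "\<exists>y\<in>carrier mpoly_ring. y \<oplus>\<^bsub>mpoly_ring\<^esub> x = \<zero>\<^bsub>mpoly_ring\<^esub>"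
      by (rule bexI[of _ "- x"]) (simp_all add: mpoly_ring_def)
  qed (simp_all add: mpoly_ring_def algebra_simps)
  show "Group.comm_monoid (mpoly_ring :: ('n, 'k) mpoly ring)"
    by (rule comm_monoidI) (simp_all add: mpoly_ring_def algebra_simps)
qed (simp add: mpoly_ring_def algebra_simps)

definition monomial :: "('n::finite \<Rightarrow>\<^sub>0 nat) \<Rightarrow> ('n, 'k::field) mpoly" where
  "monomial a = Poly_Mapping.single a 1"

definition const_poly :: "'k::field \<Rightarrow> ('n::finite, 'k) mpoly" where
  "const_poly c = Poly_Mapping.single 0 c"

definition exp_degree :: "('n::finite \<Rightarrow>\<^sub>0 nat) \<Rightarrow> nat" where
  "exp_degree a = (\<Sum>v\<in>UNIV. Poly_Mapping.lookup a v)"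

definition homogeneous_part :: "nat \<Rightarrow> ('n::finite, 'k::field) mpoly set" where
  "homogeneous_part j = {p. \<forall>a\<in>Poly_Mapping.keys p. exp_degree a = j}"

definition sum_of_variables :: "('n::finite, 'k::field) mpoly" where
  "sum_of_variables = (\<Sum>v\<in>UNIV. monomial (Poly_Mapping.single v 1))"

definition monomial_ideal :: "('n::finite, 'k::field) mpoly set \<Rightarrow> bool" where
  "monomial_ideal I \<longleftrightarrow> (\<exists>A. I = Idl\<^bsub>mpoly_ring\<^esub> (monomial ` A))"

text \<open>
  The minimal monomial generators of a monomial ideal are the monomials in it that are minimal
  with respect to divisibility. They are represented by their exponent vectors.
\<close>

definition minimal_generators :: "('n::finite, 'k::field) mpoly set \<Rightarrow> ('n \<Rightarrow>\<^sub>0 nat) set" where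
  "minimal_generators I =
     {a. monomial a \<in> I \<and>
         (\<forall>b. monomial b \<in> I \<and> (monomial b :: ('n, 'k) mpoly) dvd monomial a \<longrightarrow> b = a)}"

definition generated_in_degree :: "nat \<Rightarrow> ('n::finite, 'k::field) mpoly set \<Rightarrow> bool" where
  "generated_in_degree d I \<longleftrightarrow> (\<forall>a\<in>minimal_generators I. exp_degree a = d)"

abbreviation quotient_algebra :: "('n::finite, 'k::field) mpoly set \<Rightarrow> ('n, 'k) mpoly set ring" where
  "quotient_algebra I \<equiv> mpoly_ring Quot I"

definition residue_class :: "('n::finite, 'k::field) mpoly set \<Rightarrow> ('n, 'k) mpoly \<Rightarrow> ('n, 'k) mpoly set" where
  "residue_class I p = I +>\<^bsub>mpoly_ring\<^esub> p"

text \<open>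
  The copy of the ground field inside \<open>S/I\<close>, over which dimensions are taken.
\<close>

definition scalars :: "('n::finite, 'k::field) mpoly set \<Rightarrow> ('n, 'k) mpoly set set" where
  "scalars I = residue_class I ` range const_poly"

definition graded_piece :: "('n::finite, 'k::field) mpoly set \<Rightarrow> nat \<Rightarrow> ('n, 'k) mpoly set set" where
  "graded_piece I j = residue_class I ` homogeneous_part j"

definition artinian :: "('n::finite, 'k::field) mpoly set \<Rightarrow> bool" where
  "artinian I \<longleftrightarrow>
     ring.finite_dimension (quotient_algebra I) (scalars I) (carrier (quotient_algebra I))"

definition HF :: "('n::finite, 'k::field) mpoly set \<Rightarrow> nat \<Rightarrow> nat" where
  "HF I j = ring.dim (quotient_algebra I) (scalars I) (graded_piece I j)"

definition mult_power ::
  "('n::finite, 'k::field) mpoly set \<Rightarrow> ('n, 'k) mpoly set \<Rightarrow> nat \<Rightarrow> ('n, 'k) mpoly set \<Rightarrow> ('n, 'k) mpoly set"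
  where
  "mult_power I l i r = (l [^]\<^bsub>quotient_algebra I\<^esub> i) \<otimes>\<^bsub>quotient_algebra I\<^esub> r"

definition mult_injective ::
  "('n::finite, 'k::field) mpoly set \<Rightarrow> ('n, 'k) mpoly set \<Rightarrow> nat \<Rightarrow> nat \<Rightarrow> bool" where
  "mult_injective I l i j \<longleftrightarrow> inj_on (mult_power I l i) (graded_piece I j)"

definition mult_surjective ::
  "('n::finite, 'k::field) mpoly set \<Rightarrow> ('n, 'k) mpoly set \<Rightarrow> nat \<Rightarrow> nat \<Rightarrow> bool" where
  "mult_surjective I l i j \<longleftrightarrow> mult_power I l i ` graded_piece I j = graded_piece I (j + i)"

definition maximal_rank ::
  "('n::finite, 'k::field) mpoly set \<Rightarrow> ('n, 'k) mpoly set \<Rightarrow> nat \<Rightarrow> nat \<Rightarrow> bool" where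
  "maximal_rank I l i j \<longleftrightarrow> mult_injective I l i j \<or> mult_surjective I l i j"

definition strong_lefschetz :: "('n::finite, 'k::field) mpoly set \<Rightarrow> bool" where
  "strong_lefschetz I \<longleftrightarrow>
     (\<exists>l\<in>graded_piece I 1. \<forall>i\<ge>1. \<forall>j. maximal_rank I l i j)"

text \<open>
  The residue class of \<open>\<Sum>\<^sub>v x\<^sub>v\<close> in \<open>S/I\<close>.
\<close>

definition ell :: "('n::finite, 'k::field) mpoly set \<Rightarrow> ('n, 'k) mpoly set" where
  "ell I = residue_class I sum_of_variables"

definition artinian_monomial_ideal :: "nat \<Rightarrow> ('n::finite, 'k::field) mpoly set \<Rightarrow> bool" where
  "artinian_monomial_ideal d I \<longleftrightarrow> monomial_ideal I \<and> artinian I \<and> generated_in_degree d I"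

end

(*
  Everything is read off the set A_k of monomials of degree k outside I, a basis of R_k. Write L
  for the sum of the variables.

  The lower bounds come from interpolation: if A_k has at most j + 1 elements, where k = j + i, then
  L^i maps R_j onto R_k. Indeed all coefficients of L^k are non-zero, and applying x_v d/dx_v - b_v
  kills the monomial x^b while costing only one factor L; after at most j such steps a multiple of
  L^i is left that has a single non-zero coefficient on A_k. As surjectivity persists in higher
  degrees and L is a non-zero-divisor on S, this settles (ii). For (i), if A_d is smaller than claimed, then
  A_(d+1) has at most one element and A_k is empty for k >= d + 2, since two monomials share at most
  one divisor of codegree one; only three squarefree quadrics (a graph with three edges) need a
  separate argument.

  The extremal examples take for A_d the support of a linear functional on S_d that vanishes on
  multiples of L^i: the coefficient of z^(i-1) at x = 1, y = -1, or, for d = 2, the functional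
  dual to (x_1 - x_3)(x_2 - x_4).
*)
theory Submission
  imports Defs
begin

text \<open>Interpolation from degree j controls j + 1 monomials. With j = d - i this is the bound
  in (ii). In (i) the exponent i is free and j = 1 is the worst case: two monomials are controlled,
  whence the bound 3, and the bound 4 for d = 2 needs the extra argument on graphs. Source degree 0
  controls only one monomial, but there the source is spanned by 1, and L^i is injective unless its
  target vanishes.

  Characteristic zero makes three kinds of numbers invertible: multinomial coefficients, differences
  of distinct exponents, and the 2 that appears for a triangle.

  In the extremal examples the functional must vanish on pure powers, because every x_v^d lies in an
  artinian ideal generated in degree d. At x = 1, y = -1 a multiple of L^i becomes a multiple of
  z^i; the coefficient of z^(i-1) is the highest one that vanishes and has the smallest support. For
  i >= 2 its monomials contain z, so x^d and y^d are avoided. This fails for i = 1, which is the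
  case d = 2 of (i). The 4-cycle used there needs four variables: three variables have only three
  squarefree quadrics, so (n,d) = (3,2) is exceptional.\<close>

abbreviation lk :: "('a \<Rightarrow>\<^sub>0 'b::zero) \<Rightarrow> 'a \<Rightarrow> 'b" where
  "lk \<equiv> Poly_Mapping.lookup"

abbreviation ev :: "'n \<Rightarrow> 'n \<Rightarrow>\<^sub>0 nat" where
  "ev v \<equiv> Poly_Mapping.single v 1"

text \<open>Multiplication is convolution, which is easy to compute only on single terms; identities
  additive in \<open>p\<close> are reduced to these.\<close>

lemma poly_mapping_add_induct [case_names single add]:
  fixes p :: "'a \<Rightarrow>\<^sub>0 'b::comm_monoid_add"
  assumes single: "\<And>a c. P (Poly_Mapping.single a c)"
    and add: "\<And>p q. P p \<Longrightarrow> P q \<Longrightarrow> P (p + q)"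
  shows "P p"
proof (induction p rule: update_induct)
  case const
  show ?case using single[of undefined 0] by simp
next
  case (update f a b)
  have "Poly_Mapping.update a b f = f + Poly_Mapping.single a b"
    using update.hyps(1)
    by (intro poly_mapping_eqI) (auto simp: lookup_update lookup_add lookup_single when_def in_keys_iff)
  then show ?case using update.IH single add by simp
qed

subsection \<open>Degrees\<close>

lemma exp_degree_add: "exp_degree (a + b) = exp_degree a + exp_degree b"
  by (simp add: exp_degree_def lookup_add sum.distrib)

lemma exp_degree_zero [simp]: "exp_degree 0 = 0"
  by (simp add: exp_degree_def)

lemma exp_degree_single [simp]: "exp_degree (Poly_Mapping.single v m) = m"
  by (simp add: exp_degree_def lookup_single when_def)

lemma lookup_le_exp_degree: "lk a v \<le> exp_degree a"
  unfolding exp_degree_def by (rule member_le_sum) auto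

lemma exp_degree_eq_0_iff: "exp_degree a = 0 \<longleftrightarrow> a = 0"
  by (auto simp: exp_degree_def poly_mapping_eq_iff fun_eq_iff)

lemma divide_variable:
  assumes "lk a v > 0"
  shows "ev v + (a - ev v) = a"
  using assms by (intro poly_mapping_eqI) (auto simp: lookup_add lookup_minus lookup_single when_def)

lemma exp_degree_divide_variable:
  assumes "lk a v > 0"
  shows "exp_degree a = Suc (exp_degree (a - ev v))"
  using exp_degree_add[of "ev v" "a - ev v"] divide_variable[OF assms] by simp

lemma exists_positive_exponent:
  assumes "exp_degree a > 0"
  obtains v where "lk a v > 0"
  using assms unfolding exp_degree_def by (metis gr0I less_irrefl sum.neutral)

lemma exponents_le_add:
  fixes a b :: "'n \<Rightarrow>\<^sub>0 nat"
  assumes "\<forall>v. lk a v \<le> lk b v"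
  shows "a + (b - a) = b"
  using assms by (intro poly_mapping_eqI) (simp add: lookup_add lookup_minus)

lemma eq_if_exponents_le:
  assumes "\<forall>v. lk a v \<le> lk b v" "exp_degree a = exp_degree b"
  shows "a = b"
proof -
  have "exp_degree (b - a) = 0"
    using exp_degree_add[of a "b - a"] exponents_le_add[OF assms(1)] assms(2) by simp
  then show ?thesis
    using exponents_le_add[OF assms(1)] by (simp add: exp_degree_eq_0_iff)
qed

lemma finite_exponents_of_degree: "finite {a :: 'n::finite \<Rightarrow>\<^sub>0 nat. exp_degree a = k}"
proof (rule finite_subset)
  show "{a :: 'n \<Rightarrow>\<^sub>0 nat. exp_degree a = k} \<subseteq> Abs_poly_mapping ` (PiE UNIV (\<lambda>_. {..k}))"
  proof
    fix a :: "'n \<Rightarrow>\<^sub>0 nat"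
    assume "a \<in> {a. exp_degree a = k}"
    then have "lk a \<in> PiE UNIV (\<lambda>_. {..k})"
      using lookup_le_exp_degree[of a] by auto
    moreover have "a = Abs_poly_mapping (lk a)" by (simp add: lookup_inverse)
    ultimately show "a \<in> Abs_poly_mapping ` (PiE UNIV (\<lambda>_. {..k}))" by blast
  qed
qed (simp add: finite_PiE)

lemma homogeneous_add:
  "p \<in> homogeneous_part j \<Longrightarrow> q \<in> homogeneous_part j \<Longrightarrow> p + q \<in> homogeneous_part j"
  using keys_add[of p q] by (auto simp: homogeneous_part_def)

lemma homogeneous_zero [simp]: "0 \<in> homogeneous_part j"
  by (simp add: homogeneous_part_def)

lemma homogeneous_single: "exp_degree a = j \<Longrightarrow> Poly_Mapping.single a c \<in> homogeneous_part j"
  by (simp add: homogeneous_part_def)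

lemma homogeneous_sum:
  "(\<And>x. x \<in> X \<Longrightarrow> f x \<in> homogeneous_part j) \<Longrightarrow> sum f X \<in> homogeneous_part j"
  by (induction X rule: infinite_finite_induct) (auto intro: homogeneous_add)

lemma homogeneous_mult:
  "p \<in> homogeneous_part i \<Longrightarrow> q \<in> homogeneous_part j \<Longrightarrow> p * q \<in> homogeneous_part (i + j)"
  using keys_mult[of p q] by (fastforce simp: homogeneous_part_def exp_degree_add)

lemma homogeneous_const_mult:
  "p \<in> homogeneous_part j \<Longrightarrow> Poly_Mapping.single 0 c * p \<in> homogeneous_part j"
  using homogeneous_mult[OF homogeneous_single[OF exp_degree_zero], of p j c] by simp

lemma homogeneous_diff:
  "p \<in> homogeneous_part j \<Longrightarrow> q \<in> homogeneous_part j \<Longrightarrow> p - q \<in> homogeneous_part j"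
  using homogeneous_add[OF _ homogeneous_const_mult[of q j "- 1"], of p] by (simp add: single_uminus)

lemma homogeneous_one [simp]: "1 \<in> homogeneous_part 0"
  by (simp add: homogeneous_part_def)

lemma homogeneous_power:
  "p \<in> homogeneous_part j \<Longrightarrow> p ^ m \<in> homogeneous_part (m * j)"
  by (induction m) (auto intro: homogeneous_mult)

lemma homogeneous_sum_of_variables: "sum_of_variables \<in> homogeneous_part 1"
  unfolding sum_of_variables_def monomial_def
  by (intro homogeneous_sum homogeneous_single) simp

lemma homogeneous_sum_of_variables_power_mult:
  "q \<in> homogeneous_part j \<Longrightarrow> sum_of_variables ^ i * q \<in> homogeneous_part (j + i)"
  using homogeneous_mult[OF homogeneous_power[OF homogeneous_sum_of_variables], of q j i]
  by (simp add: add.commute)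

lemma homogeneous_lookup_eq_0:
  "p \<in> homogeneous_part j \<Longrightarrow> exp_degree a \<noteq> j \<Longrightarrow> lk p a = 0"
  by (auto simp: homogeneous_part_def in_keys_iff)

subsection \<open>Multiplication by the sum of the variables\<close>

lemma lookup_monomial_mult:
  fixes p :: "('n::finite, 'k::field) mpoly"
  shows "lk (monomial b * p) (b + a) = lk p a"
proof (induction p rule: poly_mapping_add_induct)
  case (single c x)
  then show ?case by (auto simp: monomial_def mult_single lookup_single when_def)
next
  case (add p q)
  then show ?case by (simp add: distrib_left lookup_add)
qed

lemma lookup_const_mult:
  fixes p :: "('n::finite, 'k::field) mpoly"
  shows "lk (Poly_Mapping.single 0 c * p) a = c * lk p a"
proof (induction p rule: poly_mapping_add_induct)
  case (single b x)
  then show ?case by (simp add: mult_single lookup_single when_def)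
next
  case (add p q)
  then show ?case by (simp add: distrib_left lookup_add)
qed

lemma lookup_variable_mult:
  fixes p :: "('n::finite, 'k::field) mpoly"
  shows "lk (monomial (ev v) * p) a = (if lk a v > 0 then lk p (a - ev v) else 0)"
proof (cases "lk a v > 0")
  case True
  then show ?thesis
    using lookup_monomial_mult[of "ev v" p "a - ev v"] divide_variable[OF True] by simp
next
  case False
  have "a \<notin> Poly_Mapping.keys (monomial (ev v) * p)"
  proof
    assume "a \<in> Poly_Mapping.keys (monomial (ev v) * p)"
    then obtain b where "a = ev v + b"
      using keys_mult[of "monomial (ev v)" p] by (auto simp: monomial_def)
    with False show False by (simp add: lookup_add)
  qed
  with False show ?thesis by (simp add: in_keys_iff)
qed

lemma lookup_sum_of_variables_mult:
  fixes p :: "('n::finite, 'k::field) mpoly"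
  shows "lk (sum_of_variables * p) a = (\<Sum>v | lk a v > 0. lk p (a - ev v))"
proof -
  have "lk (sum_of_variables * p) a = (\<Sum>v\<in>UNIV. lk (monomial (ev v) * p) a)"
    by (simp add: sum_of_variables_def sum_distrib_right lookup_sum)
  also have "\<dots> = (\<Sum>v\<in>UNIV. if lk a v > 0 then lk p (a - ev v) else 0)"
    by (simp only: lookup_variable_mult)
  also have "\<dots> = (\<Sum>v | lk a v > 0. lk p (a - ev v))"
    by (rule sum.mono_neutral_cong_right) auto
  finally show ?thesis .
qed

text \<open>These are multinomial coefficients. Tracking them as positive naturals makes the
  induction work: each is a non-empty sum of earlier ones, and positive summands cannot
  cancel.\<close>

lemma sum_of_variables_power_positive:
  assumes "exp_degree a = k"
  shows "\<exists>m>0. lk (sum_of_variables ^ k :: ('n::finite, 'k::field_char_0) mpoly) a = of_nat m"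
  using assms
proof (induction k arbitrary: a)
  case 0
  then show ?case by (auto simp: exp_degree_eq_0_iff intro!: exI[of _ 1])
next
  case (Suc k)
  let ?S = "{v. lk a v > 0}"
  have "\<forall>v\<in>?S. \<exists>m>0. lk (sum_of_variables ^ k :: ('n, 'k) mpoly) (a - ev v) = of_nat m"
    using Suc exp_degree_divide_variable[of a] by auto
  then obtain m where m: "\<And>v. v \<in> ?S \<Longrightarrow> m v > 0 \<and>
      lk (sum_of_variables ^ k :: ('n, 'k) mpoly) (a - ev v) = of_nat (m v)"
    by metis
  have "lk (sum_of_variables ^ Suc k :: ('n, 'k) mpoly) a = of_nat (\<Sum>v\<in>?S. m v)"
    using m by (simp add: lookup_sum_of_variables_mult)
  moreover have "?S \<noteq> {}"
    using exists_positive_exponent[of a] Suc.prems by auto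
  then have "(\<Sum>v\<in>?S. m v) > 0"
    using m by (intro sum_pos) auto
  ultimately show ?case by blast
qed

lemma sum_of_variables_power_nonzero:
  assumes "exp_degree a = k"
  shows "lk (sum_of_variables ^ k :: ('n::finite, 'k::field_char_0) mpoly) a \<noteq> 0"
  using sum_of_variables_power_positive[OF assms, where 'k = 'k] by auto

text \<open>A leading-term argument in one variable \<open>v\<close>: if \<open>a\<close> has
  maximal \<open>v\<close>-exponent in the support of \<open>p\<close>, the only contribution to the
  coefficient of x_v x^a comes from x_v itself, since any other one would need a larger
  \<open>v\<close>-exponent in \<open>p\<close>.\<close>

lemma sum_of_variables_mult_eq_0:
  fixes p :: "('n::finite, 'k::field) mpoly"
  assumes "sum_of_variables * p = 0"
  shows "p = 0"
proof (rule ccontr)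
  assume "p \<noteq> 0"
  then have ne: "Poly_Mapping.keys p \<noteq> {}"
    by (metis all_not_in_conv in_keys_iff lookup_zero poly_mapping_eqI)
  fix v :: 'n
  define M where "M = Max ((\<lambda>a. lk a v) ` Poly_Mapping.keys p)"
  have M: "lk a v \<le> M" if "a \<in> Poly_Mapping.keys p" for a
    using that by (simp add: M_def)
  have "M \<in> (\<lambda>a. lk a v) ` Poly_Mapping.keys p"
    unfolding M_def using ne by (intro Max_in) auto
  then obtain a where a: "a \<in> Poly_Mapping.keys p" "lk a v = M" by auto
  let ?b = "ev v + a"
  have zero: "lk p (?b - ev w) = 0" if "w \<noteq> v" for w
    using M[of "?b - ev w"] that a by (auto simp: in_keys_iff lookup_add lookup_minus lookup_single)
  have "lk (sum_of_variables * p) ?b = (\<Sum>w | lk ?b w > 0. if w = v then lk p a else 0)"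
    unfolding lookup_sum_of_variables_mult
    by (rule sum.cong) (use zero in \<open>auto simp del: One_nat_def\<close>)
  also have "\<dots> = lk p a"
    by (simp add: lookup_add)
  finally show False
    using a assms by (simp add: in_keys_iff)
qed

lemma sum_of_variables_power_mult_eq_0:
  fixes p :: "('n::finite, 'k::field) mpoly"
  shows "sum_of_variables ^ i * p = 0 \<Longrightarrow> p = 0"
  by (induction i) (auto simp: mult.assoc dest: sum_of_variables_mult_eq_0)

subsection \<open>Interpolation on few monomials\<close>

text \<open>The derivation x_v d/dx_v. Monomials are its eigenvectors, with the exponent of
  \<open>v\<close> as eigenvalue.\<close>

definition euler :: "'n::finite \<Rightarrow> ('n, 'k::field) mpoly \<Rightarrow> ('n, 'k) mpoly" where
  "euler v p = Poly_Mapping.mapp (\<lambda>a c. of_nat (lk a v) * c) p"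

lemma lookup_euler: "lk (euler v p) a = of_nat (lk a v) * lk p a"
  by (auto simp: euler_def lookup_mapp when_def in_keys_iff)

lemma euler_add: "euler v (p + q) = euler v p + euler v q"
  by (intro poly_mapping_eqI) (simp add: lookup_euler lookup_add algebra_simps)

lemma euler_single: "euler v (Poly_Mapping.single a c) = Poly_Mapping.single a (of_nat (lk a v) * c)"
  by (intro poly_mapping_eqI) (simp add: lookup_euler lookup_single when_def)

lemma euler_mult: "euler v (p * q) = euler v p * q + p * euler v q"
proof (induction p rule: poly_mapping_add_induct)
  case (single a c)
  show ?case
  proof (induction q rule: poly_mapping_add_induct)
    case (single b e)
    show ?case
      by (simp add: mult_single euler_single lookup_add flip: single_add) (simp add: algebra_simps)
  next
    case (add p q)
    then show ?case by (simp add: euler_add algebra_simps)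
  qed
next
  case (add p q)
  then show ?case by (simp add: euler_add algebra_simps)
qed

lemma euler_sum: "euler v (sum f X) = (\<Sum>x\<in>X. euler v (f x))"
  by (intro poly_mapping_eqI) (simp add: lookup_euler lookup_sum sum_distrib_left)

lemma euler_sum_of_variables:
  "euler v sum_of_variables = (monomial (ev v) :: ('n::finite, 'k::field) mpoly)"
proof -
  have "euler v (monomial (ev w) :: ('n, 'k) mpoly) = (if w = v then monomial (ev v) else 0)" for w
    by (simp add: monomial_def euler_single lookup_single)
  then have "euler v sum_of_variables = (\<Sum>w\<in>UNIV. if w = v then monomial (ev v) else 0 :: ('n, 'k) mpoly)"
    by (simp only: sum_of_variables_def euler_sum)
  then show ?thesis by simp
qed

lemma homogeneous_euler: "p \<in> homogeneous_part j \<Longrightarrow> euler v p \<in> homogeneous_part j"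
  by (auto simp: homogeneous_part_def in_keys_iff lookup_euler)

text \<open>For m <= k these are the forms of degree \<open>k\<close> divisible by L^(k-m);
  \<open>m\<close> counts the factors of L^k that have been spent.\<close>

definition power_multiples :: "nat \<Rightarrow> nat \<Rightarrow> ('n::finite, 'k::field) mpoly set" where
  "power_multiples k m = {sum_of_variables ^ (k - m) * g | g. g \<in> homogeneous_part m}"

text \<open>By the product rule, deriving L^(e+1) g gives (e+1) x_v L^e g plus a multiple of
  L^(e+1). So L^e still divides everything, and the spare factor L moves into the cofactor.\<close>

lemma euler_power_multiples:
  fixes p :: "('n::finite, 'k::field) mpoly"
  assumes "p \<in> power_multiples k m" "m < k"
  shows "euler v p - Poly_Mapping.single 0 c * p \<in> power_multiples k (Suc m)"
proof -
  let ?L = "sum_of_variables :: ('n, 'k) mpoly"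
  obtain g where g: "g \<in> homogeneous_part m" "p = ?L ^ (k - m) * g"
    using assms by (auto simp: power_multiples_def)
  obtain e where e: "k - m = Suc e" "k - Suc m = e"
    using assms(2) by (metis Suc_diff_Suc)
  have power: "euler v (?L ^ Suc r) = of_nat (Suc r) * (monomial (ev v) * ?L ^ r)" for r
  proof (induction r)
    case 0
    then show ?case by (simp add: euler_sum_of_variables)
  next
    case (Suc r)
    have "euler v (?L ^ Suc (Suc r)) = euler v ?L * ?L ^ Suc r + ?L * euler v (?L ^ Suc r)"
      by (simp only: power_Suc[of ?L "Suc r"] euler_mult)
    also have "\<dots> = of_nat (Suc (Suc r)) * (monomial (ev v) * ?L ^ Suc r)"
      unfolding Suc by (simp add: euler_sum_of_variables algebra_simps)
    finally show ?case .
  qed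
  let ?h = "of_nat (Suc e) * (monomial (ev v) * g) + ?L * (euler v g - Poly_Mapping.single 0 c * g)"
  have "euler v p - Poly_Mapping.single 0 c * p
      = of_nat (Suc e) * (monomial (ev v) * ?L ^ e) * g + ?L ^ Suc e * euler v g
        - Poly_Mapping.single 0 c * (?L ^ Suc e * g)"
    by (simp only: g(2) e(1) euler_mult power)
  also have "\<dots> = ?L ^ e * ?h" by (simp add: algebra_simps)
  finally have eq: "euler v p - Poly_Mapping.single 0 c * p = ?L ^ e * ?h" .
  have "monomial (ev v) * g \<in> homogeneous_part (Suc m)"
    using homogeneous_mult[OF _ g(1), of "monomial (ev v)" 1]
    by (simp add: monomial_def homogeneous_single)
  from homogeneous_const_mult[OF this, of "of_nat (Suc e)"]
  have "of_nat (Suc e) * (monomial (ev v) * g) \<in> homogeneous_part (Suc m)"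
    by (simp only: single_of_nat)
  moreover have "?L * (euler v g - Poly_Mapping.single 0 c * g) \<in> homogeneous_part (Suc m)"
    using homogeneous_mult[OF homogeneous_sum_of_variables homogeneous_diff[OF homogeneous_euler homogeneous_const_mult], OF g(1) g(1)]
    by simp
  ultimately have "?h \<in> homogeneous_part (Suc m)" by (rule homogeneous_add)
  then show ?thesis unfolding eq power_multiples_def e(2) by blast
qed

text \<open>
  All coefficients of the \<open>k\<close>-th power of the sum of the variables are non-zero, and the operator
  \<open>x\<^sub>v \<partial>\<^sub>v - b\<^sub>v\<close> annihilates the monomial with exponent vector \<open>b\<close>, at the cost of one factor of the power.
\<close>
lemma isolate_monomial:
  assumes "finite B" "exp_degree a = k" "card B \<le> k" "\<forall>b\<in>B. b \<noteq> a"
  shows "\<exists>p\<in>power_multiples k (card B). lk p a \<noteq> 0 \<and>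
           (\<forall>b\<in>B. lk (p :: ('n::finite, 'k::field_char_0) mpoly) b = 0)"
  using assms(1,3,4)
proof (induction B rule: finite_induct)
  case empty
  have "sum_of_variables ^ k * (1 :: ('n, 'k) mpoly) \<in> power_multiples k 0"
    by (auto simp: power_multiples_def intro!: exI[of _ 1])
  then show ?case
    using sum_of_variables_power_nonzero[OF assms(2), where 'k = 'k] by force
next
  case (insert b B)
  then obtain p :: "('n, 'k) mpoly" where
    p: "p \<in> power_multiples k (card B)" "lk p a \<noteq> 0" "\<forall>b\<in>B. lk p b = 0"
    by auto
  \<comment> \<open>An exponent in which \<open>a\<close> and \<open>b\<close> differ yields an
    operator that is diagonal on monomials, kills \<open>b\<close>, keeps the earlier zeros on
    \<open>B\<close>, and scales the coefficient at \<open>a\<close> by a non-zero number.\<close>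
  obtain v where v: "lk a v \<noteq> lk b v"
    using insert.prems by (metis insertI1 poly_mapping_eqI)
  let ?q = "euler v p - Poly_Mapping.single 0 (of_nat (lk b v)) * p"
  have lookup: "lk ?q c = (of_nat (lk c v) - of_nat (lk b v)) * lk p c" for c
    by (simp add: lookup_minus lookup_euler left_diff_distrib lookup_const_mult del: single_of_nat)
  have "?q \<in> power_multiples k (Suc (card B))"
    using insert by (intro euler_power_multiples[OF p(1)]) auto
  moreover have "lk ?q a \<noteq> 0" "\<forall>c\<in>insert b B. lk ?q c = 0"
    using p v by (simp_all add: lookup del: single_of_nat)
  ultimately show ?case
    unfolding card_insert_disjoint[OF insert.hyps(1,2)] by blast
qed

text \<open>Linearity in the prescribed values. Both \<open>interpolate\<close> and the passage to
  the next degree in \<open>mult_surjective_Suc\<close> only have to produce delta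
  functions.\<close>

lemma interpolate_if_deltas:
  fixes f :: "('n::finite \<Rightarrow>\<^sub>0 nat) \<Rightarrow> 'k::field"
  assumes "finite A"
    and "\<And>a. a \<in> A \<Longrightarrow> \<exists>q\<in>homogeneous_part j.
           \<forall>b\<in>A. lk (sum_of_variables ^ i * q :: ('n, 'k) mpoly) b = (if b = a then 1 else 0)"
  shows "\<exists>q\<in>homogeneous_part j. \<forall>a\<in>A. lk (sum_of_variables ^ i * q) a = f a"
proof -
  let ?L = "sum_of_variables :: ('n, 'k) mpoly"
  obtain q where q: "\<And>a. a \<in> A \<Longrightarrow> q a \<in> homogeneous_part j"
    "\<And>a b. a \<in> A \<Longrightarrow> b \<in> A \<Longrightarrow> lk (?L ^ i * q a) b = (if b = a then 1 else 0)"
    using assms(2) by metis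
  let ?q = "\<Sum>a\<in>A. Poly_Mapping.single 0 (f a) * q a"
  have "?q \<in> homogeneous_part j"
    using q(1) by (intro homogeneous_sum homogeneous_const_mult)
  moreover have "lk (?L ^ i * ?q) b = f b" if "b \<in> A" for b
  proof -
    have "lk (?L ^ i * ?q) b = (\<Sum>a\<in>A. f a * lk (?L ^ i * q a) b)"
      by (simp add: sum_distrib_left lookup_sum mult.left_commute[of "?L ^ i"] lookup_const_mult)
    also have "\<dots> = (\<Sum>a\<in>A. if b = a then f a else 0)"
      using q(2) that by (intro sum.cong) auto
    finally show ?thesis using that assms(1) by simp
  qed
  ultimately show ?thesis by blast
qed

text \<open>To isolate one monomial of \<open>A\<close>, the other \<open>card A - 1\<close> <= j
  monomials are killed at the cost of one factor L each. Of the j + i factors at least i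
  remain.\<close>

lemma interpolate:
  fixes f :: "('n::finite \<Rightarrow>\<^sub>0 nat) \<Rightarrow> 'k::field_char_0"
  assumes "finite A" "\<forall>a\<in>A. exp_degree a = j + i" "card A \<le> Suc j"
  shows "\<exists>q\<in>homogeneous_part j. \<forall>a\<in>A. lk (sum_of_variables ^ i * q) a = f a"
proof (rule interpolate_if_deltas[OF assms(1)])
  let ?L = "sum_of_variables :: ('n, 'k) mpoly"
  fix a assume a: "a \<in> A"
  let ?B = "A - {a}"
  have card: "card ?B \<le> j" using assms a by simp
  obtain p :: "('n, 'k) mpoly" where
    p: "p \<in> power_multiples (j + i) (card ?B)" "lk p a \<noteq> 0" "\<forall>b\<in>?B. lk p b = 0"
    using isolate_monomial[of ?B a "j + i", where 'k = 'k] assms a card by force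
  then obtain g where g: "g \<in> homogeneous_part (card ?B)" "p = ?L ^ (j + i - card ?B) * g"
    by (auto simp: power_multiples_def)
  \<comment> \<open>The surplus factors beyond L^i go into \<open>q\<close>, which brings its degree
    up to exactly \<open>j\<close>; the scalar normalises the value at \<open>a\<close>.\<close>
  define q where "q = Poly_Mapping.single 0 (1 / lk p a) * (?L ^ (j - card ?B) * g)"
  have "q \<in> homogeneous_part j"
    unfolding q_def
    using homogeneous_const_mult[OF homogeneous_sum_of_variables_power_mult[OF g(1), of "j - card ?B"]]
      card by simp
  moreover have "?L ^ i * q = Poly_Mapping.single 0 (1 / lk p a) * p"
  proof -
    have "j + i - card ?B = i + (j - card ?B)" using card by simp
    then show ?thesis by (simp add: q_def g(2) power_add algebra_simps)
  qed
  then have "\<forall>b\<in>A. lk (?L ^ i * q) b = (if b = a then 1 else 0)"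
    using p by (auto simp: lookup_const_mult)
  ultimately show "\<exists>q\<in>homogeneous_part j. \<forall>b\<in>A. lk (?L ^ i * q) b = (if b = a then 1 else 0)"
    by blast
qed

subsection \<open>Quotients by monomial ideals\<close>

interpretation mpoly_ring: cring "mpoly_ring :: ('n::finite, 'k::field) mpoly ring"
  by (rule cring_mpoly_ring)

lemma mpoly_ring_simps [simp]:
  "carrier mpoly_ring = UNIV" "mult mpoly_ring = (*)" "one mpoly_ring = 1"
  "zero mpoly_ring = 0" "add mpoly_ring = (+)"
  by (simp_all add: mpoly_ring_def)

lemma a_inv_mpoly_ring: "\<ominus>\<^bsub>mpoly_ring\<^esub> p = - (p :: ('n::finite, 'k::field) mpoly)"
  by (rule mpoly_ring.minus_equality) simp_all

lemma keys_monomial [simp]: "Poly_Mapping.keys (monomial a :: ('n::finite, 'k::field) mpoly) = {a}"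
  by (simp add: monomial_def)

lemma monomial_mult: "monomial (a + b) = (monomial a * monomial b :: ('n::finite, 'k::field) mpoly)"
  by (simp add: monomial_def mult_single)

lemma monomial_dvd_iff:
  "(monomial a :: ('n::finite, 'k::field) mpoly) dvd monomial b \<longleftrightarrow> (\<exists>c. b = a + c)"
proof
  assume "(monomial a :: ('n, 'k) mpoly) dvd monomial b"
  then obtain q :: "('n, 'k) mpoly" where q: "monomial b = monomial a * q" by (elim dvdE)
  have "b \<in> Poly_Mapping.keys (monomial a * q)" unfolding q[symmetric] by simp
  then show "\<exists>c. b = a + c" using keys_mult[of "monomial a" q] by auto
qed (auto simp: monomial_mult)

text \<open>The combinatorial form of a monomial ideal: membership is decided monomial by monomial,
  and its monomials are closed under multiples. The ideal laws follow from this;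
  \<open>monomial_ideal_iff\<close> is the link to the definition.\<close>

locale monomial_quotient =
  fixes I :: "('n::finite, 'k::field) mpoly set"
  assumes mem_iff: "p \<in> I \<longleftrightarrow> (\<forall>a\<in>Poly_Mapping.keys p. monomial a \<in> I)"
    and monomial_add_mem: "monomial a \<in> I \<Longrightarrow> monomial (a + b) \<in> I"
begin

lemma zero_mem: "0 \<in> I"
  by (subst mem_iff) simp

lemma add_mem: "p \<in> I \<Longrightarrow> q \<in> I \<Longrightarrow> p + q \<in> I"
  using keys_add[of p q] mem_iff[of p] mem_iff[of q] mem_iff[of "p + q"] by blast

lemma mult_mem: "p \<in> I \<Longrightarrow> q * p \<in> I"
proof (subst mem_iff, rule ballI)
  fix a
  assume "p \<in> I" "a \<in> Poly_Mapping.keys (q * p)"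
  then obtain b c where "a = b + c" "c \<in> Poly_Mapping.keys p"
    using keys_mult[of q p] by auto
  with \<open>p \<in> I\<close> show "monomial a \<in> I"
    using mem_iff[of p] monomial_add_mem[of c b] by (simp add: add.commute)
qed

lemma uminus_mem: "p \<in> I \<Longrightarrow> - p \<in> I"
  using mult_mem[of p "- 1"] by simp

lemma diff_mem: "p \<in> I \<Longrightarrow> q \<in> I \<Longrightarrow> p - q \<in> I"
  using add_mem[of p "- q"] uminus_mem by simp

sublocale ideal I mpoly_ring
proof (rule idealI)
  show "ring mpoly_ring" ..
  show "subgroup I (add_monoid mpoly_ring)"
    by (rule mpoly_ring.add.subgroupI)
      (use zero_mem add_mem uminus_mem in \<open>auto simp: a_inv_mpoly_ring simp flip: a_inv_def\<close>)
  show "x \<otimes>\<^bsub>mpoly_ring\<^esub> a \<in> I" "a \<otimes>\<^bsub>mpoly_ring\<^esub> x \<in> I" if "a \<in> I" for a x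
    using mult_mem[OF that, of x] by (simp_all add: mult.commute)
qed

abbreviation R where "R \<equiv> quotient_algebra I"

sublocale Q: cring R
  by (rule quotient_is_cring) (rule cring_mpoly_ring)

sublocale res: ring_hom_ring mpoly_ring R "residue_class I"
  using rcos_ring_hom_ring unfolding residue_class_def[abs_def] .

lemma residue_class_eq_iff: "residue_class I p = residue_class I q \<longleftrightarrow> p - q \<in> I"
proof -
  have mem: "x \<in> residue_class I p \<longleftrightarrow> x - p \<in> I" for x p
    by (force simp: residue_class_def a_r_coset_def r_coset_def algebra_simps)
  show ?thesis
  proof
    assume "residue_class I p = residue_class I q"
    then show "p - q \<in> I" using mem[of p p] mem[of p q] zero_mem by simp
  next
    assume pq: "p - q \<in> I"
    have "x - p \<in> I \<longleftrightarrow> x - q \<in> I" for x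
      using add_mem[OF _ pq, of "x - p"] diff_mem[OF _ pq, of "x - q"] by auto
    then show "residue_class I p = residue_class I q" using mem by blast
  qed
qed

lemma carrier_quotient: "carrier R = range (residue_class I)"
  by (auto simp: FactRing_def A_RCOSETS_def RCOSETS_def residue_class_def a_r_coset_def)

lemma residue_class_mult: "residue_class I p \<otimes>\<^bsub>R\<^esub> residue_class I q = residue_class I (p * q)"
  using res.hom_mult[of p q] by simp

lemma residue_class_add: "residue_class I p \<oplus>\<^bsub>R\<^esub> residue_class I q = residue_class I (p + q)"
  using res.hom_add[of p q] by simp

lemma zero_quotient: "\<zero>\<^bsub>R\<^esub> = residue_class I 0"
  using res.hom_zero by simp

lemma residue_class_power: "residue_class I p [^]\<^bsub>R\<^esub> m = residue_class I (p ^ m)"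
  by (induction m) (use res.hom_one in \<open>simp_all add: residue_class_mult mult.commute\<close>)

lemma mult_power_residue_class:
  "mult_power I (residue_class I l) i (residue_class I p) = residue_class I (l ^ i * p)"
  by (simp add: mult_power_def residue_class_power residue_class_mult)

text \<open>The standard monomials; their residue classes form a basis of the graded piece, as used
  in \<open>HF_eq_card_std\<close>.\<close>

definition std :: "nat \<Rightarrow> ('n \<Rightarrow>\<^sub>0 nat) set" where
  "std k = {a. exp_degree a = k \<and> monomial a \<notin> I}"

lemma finite_std: "finite (std k)"
  unfolding std_def by (rule finite_subset[OF _ finite_exponents_of_degree[of k]]) auto

lemma homogeneous_diff_mem_iff:
  assumes "p \<in> homogeneous_part k" "q \<in> homogeneous_part k"
  shows "p - q \<in> I \<longleftrightarrow> (\<forall>a\<in>std k. lk p a = lk q a)"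
  using homogeneous_diff[OF assms] mem_iff[of "p - q"]
  by (auto simp: std_def homogeneous_part_def in_keys_iff lookup_minus)

text \<open>A class of degree j + i is determined by its coefficients on the standard monomials, so
  surjectivity becomes an interpolation problem for polynomials.\<close>

lemma mult_surjective_iff:
  "mult_surjective I (ell I) i j \<longleftrightarrow>
     (\<forall>p\<in>homogeneous_part (j + i). \<exists>q\<in>homogeneous_part j.
        \<forall>a\<in>std (j + i). lk (sum_of_variables ^ i * q :: ('n, 'k) mpoly) a = lk p a)"
proof -
  let ?L = "sum_of_variables :: ('n, 'k) mpoly"
  have eq: "residue_class I (?L ^ i * q) = residue_class I p \<longleftrightarrow>
      (\<forall>a\<in>std (j + i). lk (?L ^ i * q) a = lk p a)"
    if "p \<in> homogeneous_part (j + i)" "q \<in> homogeneous_part j" for p q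
    using homogeneous_diff_mem_iff[OF homogeneous_sum_of_variables_power_mult[OF that(2)] that(1)]
    by (simp only: residue_class_eq_iff)
  have image: "mult_power I (ell I) i ` graded_piece I j =
      (\<lambda>q. residue_class I (?L ^ i * q)) ` homogeneous_part j"
    by (simp only: graded_piece_def ell_def image_image mult_power_residue_class)
  show ?thesis
  proof
    assume "mult_surjective I (ell I) i j"
    then have surj: "residue_class I ` homogeneous_part (j + i) =
        (\<lambda>q. residue_class I (?L ^ i * q)) ` homogeneous_part j"
      by (simp only: mult_surjective_def image) (simp only: graded_piece_def)
    show "\<forall>p\<in>homogeneous_part (j + i). \<exists>q\<in>homogeneous_part j.
        \<forall>a\<in>std (j + i). lk (?L ^ i * q) a = lk p a"
    proof (rule ballI)
      fix p :: "('n, 'k) mpoly"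
      assume p: "p \<in> homogeneous_part (j + i)"
      then have "residue_class I p \<in> (\<lambda>q. residue_class I (?L ^ i * q)) ` homogeneous_part j"
        using surj by blast
      then obtain q where "q \<in> homogeneous_part j" "residue_class I (?L ^ i * q) = residue_class I p"
        by (auto simp only: image_iff)
      then show "\<exists>q\<in>homogeneous_part j. \<forall>a\<in>std (j + i). lk (?L ^ i * q) a = lk p a"
        using eq[OF p] by blast
    qed
  next
    assume R: "\<forall>p\<in>homogeneous_part (j + i). \<exists>q\<in>homogeneous_part j.
        \<forall>a\<in>std (j + i). lk (?L ^ i * q) a = lk p a"
    have "(\<lambda>q. residue_class I (?L ^ i * q)) ` homogeneous_part j = residue_class I ` homogeneous_part (j + i)"
    proof (intro equalityI image_subsetI)
      fix q :: "('n, 'k) mpoly"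
      assume "q \<in> homogeneous_part j"
      then show "residue_class I (?L ^ i * q) \<in> residue_class I ` homogeneous_part (j + i)"
        by (intro imageI) (rule homogeneous_sum_of_variables_power_mult)
    next
      fix p :: "('n, 'k) mpoly"
      assume p: "p \<in> homogeneous_part (j + i)"
      then obtain q where q: "q \<in> homogeneous_part j" "\<forall>a\<in>std (j + i). lk (?L ^ i * q) a = lk p a"
        using R by blast
      then have "residue_class I p = residue_class I (?L ^ i * q)"
        using eq[OF p q(1)] by simp
      then show "residue_class I p \<in> (\<lambda>q. residue_class I (?L ^ i * q)) ` homogeneous_part j"
        using q(1) by (rule image_eqI)
    qed
    then show "mult_surjective I (ell I) i j"
      by (simp only: mult_surjective_def image) (simp only: graded_piece_def)
  qed
qed

lemma mult_injectiveI:
  assumes "\<And>q. q \<in> homogeneous_part j \<Longrightarrow> sum_of_variables ^ i * q \<in> I \<Longrightarrow> q \<in> I"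
  shows "mult_injective I (ell I) i j"
  unfolding mult_injective_def
proof (rule inj_onI)
  fix x y
  assume "x \<in> graded_piece I j" "y \<in> graded_piece I j"
    and eq: "mult_power I (ell I) i x = mult_power I (ell I) i y"
  then obtain p q where pq: "p \<in> homogeneous_part j" "q \<in> homogeneous_part j"
    "x = residue_class I p" "y = residue_class I q"
    by (auto simp: graded_piece_def)
  have "sum_of_variables ^ i * (p - q) \<in> I"
    using eq by (simp add: pq ell_def mult_power_residue_class residue_class_eq_iff right_diff_distrib)
  then show "x = y"
    using assms[OF homogeneous_diff[OF pq(1,2)]] by (simp add: pq residue_class_eq_iff)
qed

section \<open>Bases of standard monomials and dimensions\<close>

lemma residue_class_standard_part:
  "\<exists>q. Poly_Mapping.keys q \<subseteq> {a \<in> Poly_Mapping.keys p. monomial a \<notin> I} \<and>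
       residue_class I p = residue_class I q"
proof -
  define q where "q = Poly_Mapping.mapp (\<lambda>a c. if monomial a \<in> I then 0 else c) p"
  have q: "lk q a = (if monomial a \<in> I then 0 else lk p a)" for a
    by (auto simp: q_def lookup_mapp when_def in_keys_iff)
  have "p - q \<in> I"
    by (subst mem_iff) (auto simp: in_keys_iff lookup_minus q split: if_splits)
  moreover have "Poly_Mapping.keys q \<subseteq> {a \<in> Poly_Mapping.keys p. monomial a \<notin> I}"
    by (auto simp: in_keys_iff q split: if_splits)
  ultimately show ?thesis using residue_class_eq_iff by blast
qed

lemma Span_monomials:
  "Q.Span (scalars I) (map (\<lambda>a. residue_class I (monomial a)) as) =
     residue_class I ` {p. Poly_Mapping.keys p \<subseteq> set as}"
proof (induction as)
  case Nil
  have "{p :: ('n, 'k) mpoly. Poly_Mapping.keys p \<subseteq> {}} = {0}"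
    by (auto simp: in_keys_iff intro!: poly_mapping_eqI)
  then show ?case by (simp add: zero_quotient)
next
  case (Cons a as)
  have keys: "Poly_Mapping.keys q \<subseteq> set (a # as) \<longleftrightarrow>
      (\<exists>c p. Poly_Mapping.keys p \<subseteq> set as \<and> q = Poly_Mapping.single a c + p)" for q :: "('n, 'k) mpoly"
  proof
    assume "Poly_Mapping.keys q \<subseteq> set (a # as)"
    then have "Poly_Mapping.keys (q - Poly_Mapping.single a (lk q a)) \<subseteq> set as"
      by (auto simp: in_keys_iff lookup_minus lookup_single when_def split: if_splits)
    then show "\<exists>c p. Poly_Mapping.keys p \<subseteq> set as \<and> q = Poly_Mapping.single a c + p"
      by (intro exI[of _ "lk q a"] exI[of _ "q - Poly_Mapping.single a (lk q a)"]) simp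
  next
    assume "\<exists>c p. Poly_Mapping.keys p \<subseteq> set as \<and> q = Poly_Mapping.single a c + p"
    then obtain c p where p: "Poly_Mapping.keys p \<subseteq> set as" "q = Poly_Mapping.single a c + p"
      by blast
    have "Poly_Mapping.keys (Poly_Mapping.single a c) \<subseteq> {a}" by simp
    with p show "Poly_Mapping.keys q \<subseteq> set (a # as)"
      using keys_add[of "Poly_Mapping.single a c" p] by auto
  qed
  have scalar: "residue_class I (const_poly c) \<otimes>\<^bsub>R\<^esub> residue_class I (monomial a) \<oplus>\<^bsub>R\<^esub> residue_class I p
      = residue_class I (Poly_Mapping.single a c + p)" for c p
    by (simp add: residue_class_mult residue_class_add const_poly_def monomial_def mult_single)
  have "Q.line_extension (scalars I) (residue_class I (monomial a))
      (residue_class I ` {p. Poly_Mapping.keys p \<subseteq> set as}) =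
      residue_class I ` {p. Poly_Mapping.keys p \<subseteq> set (a # as)}" (is "?A = ?B")
  proof (intro equalityI subsetI)
    fix u assume "u \<in> ?A"
    then obtain c p where "Poly_Mapping.keys p \<subseteq> set as"
      "u = residue_class I (Poly_Mapping.single a c + p)"
      unfolding Q.line_extension_mem_iff scalars_def using scalar by auto
    then show "u \<in> ?B" using keys by blast
  next
    fix u assume "u \<in> ?B"
    then obtain c p where "Poly_Mapping.keys p \<subseteq> set as"
      "u = residue_class I (Poly_Mapping.single a c + p)"
      using keys by auto
    then show "u \<in> ?A"
      unfolding Q.line_extension_mem_iff scalars_def scalar[symmetric] by blast
  qed
  then show ?case using Cons by simp
qed

text \<open>A dependence puts some \<open>monomial a - p\<close> into \<open>I\<close> with
  \<open>a\<close> outside the support of \<open>p\<close>. Then \<open>a\<close> lies in the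
  support of the difference, which forces its monomial into \<open>I\<close>.\<close>

lemma independent_monomials:
  assumes "distinct as" "\<forall>a\<in>set as. monomial a \<notin> I"
  shows "Q.independent (scalars I) (map (\<lambda>a. residue_class I (monomial a)) as)"
  using assms
proof (induction as)
  case (Cons a as)
  have "residue_class I (monomial a) \<notin>
      Q.Span (scalars I) (map (\<lambda>a. residue_class I (monomial a)) as)"
  proof
    assume "residue_class I (monomial a) \<in>
      Q.Span (scalars I) (map (\<lambda>a. residue_class I (monomial a)) as)"
    then obtain p where p: "Poly_Mapping.keys p \<subseteq> set as" "monomial a - p \<in> I"
      unfolding Span_monomials by (auto simp: residue_class_eq_iff)
    have "a \<notin> Poly_Mapping.keys p" using p(1) Cons.prems(1) by auto
    then have "a \<in> Poly_Mapping.keys (monomial a - p)"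
      by (simp add: in_keys_iff lookup_minus monomial_def)
    then show False using p(2) mem_iff[of "monomial a - p"] Cons.prems(2) by (simp del: keys_monomial)
  qed
  then show ?case
    using Cons by (auto intro!: Q.li_Cons simp: carrier_quotient)
qed auto

context
  assumes proper: "monomial 0 \<notin> I"
begin

text \<open>The constants are a field in the polynomial ring, and their image stays one because
  properness gives 1 \<noteq> 0 in the quotient.\<close>

lemma subfield_scalars: "subfield (scalars I) R"
proof -
  have const: "const_poly c * const_poly c' = (const_poly (c * c') :: ('n, 'k) mpoly)"
    "const_poly c + const_poly c' = (const_poly (c + c') :: ('n, 'k) mpoly)"
    "- const_poly c = (const_poly (- c) :: ('n, 'k) mpoly)"
    "(const_poly 1 :: ('n, 'k) mpoly) = 1" "(const_poly 0 :: ('n, 'k) mpoly) = 0" for c c'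
    unfolding const_poly_def by (rule mult_single[of 0 _ 0, unfolded add_0]
      single_add[symmetric] single_uminus[symmetric] single_one single_zero)+
  have "subfield (range const_poly) (mpoly_ring :: ('n, 'k) mpoly ring)"
  proof (rule mpoly_ring.subfieldI)
    have "subring (range const_poly) (mpoly_ring :: ('n, 'k) mpoly ring)"
    proof (rule mpoly_ring.subringI)
      show "\<one>\<^bsub>mpoly_ring\<^esub> \<in> range (const_poly :: 'k \<Rightarrow> ('n, 'k) mpoly)"
        using const(4) by (metis mpoly_ring_simps(3) rangeI)
      fix h h' :: "('n, 'k) mpoly"
      assume "h \<in> range const_poly" "h' \<in> range const_poly"
      then obtain c c' where h: "h = const_poly c" "h' = const_poly c'" by blast
      show "\<ominus>\<^bsub>mpoly_ring\<^esub> h \<in> range const_poly"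
        "h \<otimes>\<^bsub>mpoly_ring\<^esub> h' \<in> range const_poly" "h \<oplus>\<^bsub>mpoly_ring\<^esub> h' \<in> range const_poly"
        unfolding h a_inv_mpoly_ring mpoly_ring_simps const by (rule rangeI)+
    qed simp
    then show "subcring (range const_poly) (mpoly_ring :: ('n, 'k) mpoly ring)"
      by (rule mpoly_ring.subcringI')
    show "Units ((mpoly_ring :: ('n, 'k) mpoly ring)\<lparr>carrier := range const_poly\<rparr>) =
        range const_poly - {\<zero>\<^bsub>mpoly_ring\<^esub>}" (is "?A = ?B")
    proof (intro equalityI subsetI)
      fix x assume "x \<in> ?A"
      then obtain y where "x \<in> range const_poly" "y * x = 1"
        by (auto simp: Units_def)
      moreover from this have "x \<noteq> 0" by auto
      ultimately show "x \<in> ?B" by simp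
    next
      fix x assume "x \<in> ?B"
      then obtain c where c: "x = const_poly c" "c \<noteq> 0"
        using const(5) by auto
      have "const_poly (inverse c) * x = 1" "x * const_poly (inverse c) = 1"
        unfolding c(1) const(1) using c(2) const(4) by simp_all
      then show "x \<in> ?A"
        unfolding Units_def c(1) by auto
    qed
  qed
  moreover have "residue_class I 1 \<noteq> residue_class I 0"
    using proper by (simp add: residue_class_eq_iff monomial_def)
  then have "\<one>\<^bsub>R\<^esub> \<noteq> \<zero>\<^bsub>R\<^esub>"
    using res.hom_one zero_quotient by simp
  ultimately show ?thesis
    unfolding scalars_def by (rule res.img_is_subfield)
qed

lemma HF_eq_card_std: "HF I k = card (std k)"
proof -
  obtain as where as: "set as = std k" "distinct as"
    using finite_distinct_list[OF finite_std] by blast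
  let ?Us = "map (\<lambda>a. residue_class I (monomial a)) as"
  have "residue_class I ` {p. Poly_Mapping.keys p \<subseteq> set as} = graded_piece I k"
  proof (intro equalityI subsetI)
    fix x assume "x \<in> residue_class I ` {p. Poly_Mapping.keys p \<subseteq> set as}"
    then show "x \<in> graded_piece I k"
      by (auto simp: graded_piece_def homogeneous_part_def as std_def)
  next
    fix x assume "x \<in> graded_piece I k"
    then obtain p where p: "p \<in> homogeneous_part k" "x = residue_class I p"
      by (auto simp: graded_piece_def)
    obtain q where "Poly_Mapping.keys q \<subseteq> {a \<in> Poly_Mapping.keys p. monomial a \<notin> I}"
      "residue_class I p = residue_class I q"
      using residue_class_standard_part by blast
    moreover from this p have "Poly_Mapping.keys q \<subseteq> set as"
      by (auto simp: as std_def homogeneous_part_def)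
    ultimately show "x \<in> residue_class I ` {p. Poly_Mapping.keys p \<subseteq> set as}"
      using p by blast
  qed
  then have "Q.dimension (length ?Us) (scalars I) (graded_piece I k)"
    using as by (intro Q.dimensionI[OF subfield_scalars] independent_monomials)
      (auto simp: Span_monomials std_def simp del: Q.Span.simps)
  then have "HF I k = length ?Us"
    using Q.dimI[OF subfield_scalars] unfolding HF_def over_def by blast
  then show ?thesis using as distinct_card by force
qed

text \<open>If no power of x_v were in \<open>I\<close>, the powers would give n + 1 independent
  classes in a space of dimension n.\<close>

lemma artinian_imp_power_mem:
  assumes "artinian I"
  obtains m where "monomial (Poly_Mapping.single v m) \<in> I"
proof -
  obtain n where n: "Q.dimension n (scalars I) (carrier R)"
    using assms unfolding artinian_def Q.finite_dimension_def by blast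
  have False if "\<forall>m. monomial (Poly_Mapping.single v m) \<notin> I"
  proof -
    let ?as = "map (Poly_Mapping.single v) [0..<Suc n]"
    have "inj (Poly_Mapping.single v :: nat \<Rightarrow> _)"
      by (rule injI) (metis lookup_single_eq)
    then have "distinct ?as"
      unfolding distinct_map by (blast intro: distinct_upt inj_on_subset)
    then have "Q.independent (scalars I) (map (\<lambda>a. residue_class I (monomial a)) ?as)"
      using that by (intro independent_monomials) auto
    from Q.independent_length_le_dimension[OF subfield_scalars n this]
    show False by (auto simp: carrier_quotient)
  qed
  then show ?thesis using that by blast
qed

lemma artinian_if_finite:
  assumes "finite {a. monomial a \<notin> I}"
  shows "artinian I"
proof -
  obtain as where as: "set as = {a. monomial a \<notin> I}" "distinct as"
    using finite_distinct_list[OF assms] by blast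
  let ?Us = "map (\<lambda>a. residue_class I (monomial a)) as"
  have "residue_class I ` {p. Poly_Mapping.keys p \<subseteq> set as} = carrier R"
  proof (intro equalityI subsetI)
    fix x assume "x \<in> carrier R"
    then obtain p where p: "x = residue_class I p"
      by (auto simp: carrier_quotient)
    obtain q where "Poly_Mapping.keys q \<subseteq> {a \<in> Poly_Mapping.keys p. monomial a \<notin> I}"
      "residue_class I p = residue_class I q"
      using residue_class_standard_part by blast
    moreover from this have "Poly_Mapping.keys q \<subseteq> set as" by (auto simp: as)
    ultimately show "x \<in> residue_class I ` {p. Poly_Mapping.keys p \<subseteq> set as}"
      using p by blast
  qed (auto simp: carrier_quotient)
  then have "Q.dimension (length ?Us) (scalars I) (carrier R)"
    using as by (intro Q.dimensionI[OF subfield_scalars] independent_monomials)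
      (auto simp: Span_monomials simp del: Q.Span.simps)
  then show ?thesis
    unfolding artinian_def Q.finite_dimension_def by blast
qed

end

end

section \<open>Ideals generated by monomials\<close>

lemma Idl_monomials:
  "Idl\<^bsub>mpoly_ring\<^esub> (monomial ` A) =
     {p :: ('n::finite, 'k::field) mpoly. \<forall>a\<in>Poly_Mapping.keys p. \<exists>g\<in>A. \<exists>b. a = g + b}" (is "_ = ?J")
proof -
  interpret J: monomial_quotient ?J
    by unfold_locales (auto, metis add.assoc)
  let ?I = "Idl\<^bsub>mpoly_ring\<^esub> (monomial ` A) :: ('n, 'k) mpoly set"
  interpret I: ideal ?I mpoly_ring
    by (rule mpoly_ring.genideal_ideal) simp
  show ?thesis
  proof
    show "?I \<subseteq> ?J"
      by (rule mpoly_ring.genideal_minimal[OF J.is_ideal]) (force intro: exI[of _ 0])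
  next
    have gen: "monomial g \<in> ?I" if "g \<in> A" for g
      using mpoly_ring.genideal_self[of "monomial ` A"] that by auto
    \<comment> \<open>Terms are split off one at a time. The induction runs over a finite set
      containing the support, so that removing the term at \<open>a\<close> leaves a polynomial
      covered by the smaller set.\<close>
    have "p \<in> ?I" if "finite K" "Poly_Mapping.keys p \<subseteq> K" "p \<in> ?J" for p K
      using that
    proof (induction K arbitrary: p rule: finite_induct)
      case empty
      then have "p = 0" by (auto simp: in_keys_iff intro!: poly_mapping_eqI)
      then show ?case using I.zero_closed by simp
    next
      case (insert a K)
      let ?q = "p - Poly_Mapping.single a (lk p a)"
      have keys: "Poly_Mapping.keys ?q \<subseteq> Poly_Mapping.keys p - {a}"
        by (auto simp: in_keys_iff lookup_minus lookup_single when_def split: if_splits)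
      then have "?q \<in> ?I"
        using insert.prems by (intro insert.IH) auto
      moreover have "Poly_Mapping.single a (lk p a) \<in> ?I"
      proof (cases "a \<in> Poly_Mapping.keys p")
        case True
        then obtain g b where g: "g \<in> A" "a = g + b" using insert.prems(2) by auto
        have "Poly_Mapping.single a (lk p a) = Poly_Mapping.single b (lk p a) * monomial g"
          by (simp add: monomial_def mult_single g add.commute)
        then show ?thesis
          using I.I_l_closed[OF gen[OF g(1)], of "Poly_Mapping.single b (lk p a)"] by simp
      next
        case False
        then show ?thesis using I.zero_closed by (simp add: in_keys_iff)
      qed
      ultimately show ?case
        using I.a_closed[of ?q "Poly_Mapping.single a (lk p a)"] by simp
    qed
    then show "?J \<subseteq> ?I"
      using finite_keys by blast
  qed
qed

text \<open>For the converse direction, all monomials of \<open>I\<close> serve as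
  generators.\<close>

lemma monomial_ideal_iff: "monomial_ideal I \<longleftrightarrow> monomial_quotient I"
proof
  assume "monomial_ideal I"
  then obtain A where A: "I = Idl\<^bsub>mpoly_ring\<^esub> (monomial ` A)" by (auto simp: monomial_ideal_def)
  show "monomial_quotient I"
    unfolding A Idl_monomials by unfold_locales (auto, metis add.assoc)
next
  assume "monomial_quotient I"
  then interpret monomial_quotient I .
  have "monomial a \<in> I \<longleftrightarrow> (\<exists>g\<in>{a. monomial a \<in> I}. \<exists>b. a = g + b)" for a
    using monomial_add_mem by (force intro: exI[of _ 0])
  then have "I = Idl\<^bsub>mpoly_ring\<^esub> (monomial ` {a. monomial a \<in> I})"
    unfolding Idl_monomials using mem_iff by blast
  then show "monomial_ideal I" unfolding monomial_ideal_def by blast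
qed

subsection \<open>Ideals generated in one degree\<close>

lemma mult_surjective_if_interpolates:
  fixes I :: "('n::finite, 'k::field) mpoly set"
  assumes "monomial_quotient I"
    and "\<And>f :: ('n \<Rightarrow>\<^sub>0 nat) \<Rightarrow> 'k. \<exists>q\<in>homogeneous_part j.
      \<forall>a\<in>monomial_quotient.std I (j + i). lk (sum_of_variables ^ i * q) a = f a"
  shows "mult_surjective I (ell I) i j"
  using assms by (simp add: monomial_quotient.mult_surjective_iff)

lemma mult_surjective_if_card_le:
  fixes I :: "('n::finite, 'k::field_char_0) mpoly set"
  assumes "monomial_quotient I" "card (monomial_quotient.std I (j + i)) \<le> Suc j"
  shows "mult_surjective I (ell I) i j"
proof (rule mult_surjective_if_interpolates[OF assms(1)])
  interpret monomial_quotient I by fact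
  show "\<exists>q\<in>homogeneous_part j. \<forall>a\<in>std (j + i). lk (sum_of_variables ^ i * q) a = f a"
    for f :: "('n \<Rightarrow>\<^sub>0 nat) \<Rightarrow> 'k"
    by (rule interpolate[OF finite_std _ assms(2)]) (simp add: std_def)
qed

context monomial_quotient
begin

lemma std_divide_variable:
  assumes "a \<in> std (Suc k)" "lk a v > 0"
  shows "a - ev v \<in> std k"
  using assms exp_degree_divide_variable[OF assms(2)] monomial_add_mem[of "a - ev v" "ev v"]
    divide_variable[OF assms(2)]
  by (auto simp: std_def add.commute)

text \<open>Every standard monomial of the next degree is x_v times a standard one. Multiplying a
  preimage of the latter by x_v gives a preimage of the former: coefficients at monomials divisible
  by x_v are shifted, all others are zero.\<close>

lemma mult_surjective_Suc:
  assumes "mult_surjective I (ell I) i j"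
  shows "mult_surjective I (ell I) i (Suc j)"
proof (rule mult_surjective_if_interpolates[OF monomial_quotient_axioms])
  let ?L = "sum_of_variables :: ('n, 'k) mpoly"
  show "\<exists>q\<in>homogeneous_part (Suc j). \<forall>a\<in>std (Suc j + i). lk (?L ^ i * q) a = f a"
    for f :: "('n \<Rightarrow>\<^sub>0 nat) \<Rightarrow> 'k"
  proof (rule interpolate_if_deltas[OF finite_std])
    fix a assume a: "a \<in> std (Suc j + i)"
    then obtain v where v: "lk a v > 0"
      using exists_positive_exponent[of a] by (auto simp: std_def)
    have std: "b - ev v \<in> std (j + i)" if "b \<in> std (Suc j + i)" "lk b v > 0" for b
      using std_divide_variable that by simp
    have "monomial (a - ev v) \<in> homogeneous_part (j + i)"
      unfolding monomial_def by (rule homogeneous_single) (use std[OF a v] in \<open>simp add: std_def\<close>)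
    then obtain q :: "('n, 'k) mpoly" where q: "q \<in> homogeneous_part j"
      "\<forall>b\<in>std (j + i). lk (?L ^ i * q) b = lk (monomial (a - ev v)) b"
      using assms unfolding mult_surjective_iff by blast
    let ?q = "monomial (ev v) * q"
    have "?q \<in> homogeneous_part (Suc j)"
      using homogeneous_mult[OF homogeneous_single[OF exp_degree_single] q(1), of v 1 1]
      by (simp add: monomial_def)
    moreover have "lk (?L ^ i * ?q) b = (if b = a then 1 else 0)" if b: "b \<in> std (Suc j + i)" for b
    proof (cases "lk b v > 0")
      case True
      then have "b - ev v = a - ev v \<longleftrightarrow> b = a"
        using divide_variable[OF v] divide_variable[OF True] by metis
      moreover have "lk (?L ^ i * ?q) b = lk (?L ^ i * q) (b - ev v)"
        by (simp only: mult.left_commute[of "?L ^ i"] lookup_variable_mult True if_True)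
      ultimately show ?thesis
        using q(2) std[OF b True] by (auto simp: monomial_def lookup_single)
    next
      case False
      then have "lk (?L ^ i * ?q) b = 0"
        by (simp only: mult.left_commute[of "?L ^ i"] lookup_variable_mult if_False)
      then show ?thesis using v False by auto
    qed
    ultimately show "\<exists>q\<in>homogeneous_part (Suc j).
        \<forall>b\<in>std (Suc j + i). lk (?L ^ i * q) b = (if b = a then 1 else 0)"
      by blast
  qed
qed

lemma mult_surjective_mono:
  assumes "mult_surjective I (ell I) i j" "j \<le> j'"
  shows "mult_surjective I (ell I) i j'"
  using assms(2,1) by (induction rule: dec_induct) (auto intro: mult_surjective_Suc)

text \<open>Descent on the degree: a monomial of \<open>I\<close> that is not minimal has a proper
  divisor in \<open>I\<close>.\<close>

lemma mem_minimal_generator: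
  assumes "monomial a \<in> I"
  shows "\<exists>b\<in>minimal_generators I. \<exists>c. a = b + c"
  using assms
proof (induction "exp_degree a" arbitrary: a rule: less_induct)
  case less
  show ?case
  proof (cases "a \<in> minimal_generators I")
    case True
    then show ?thesis by (auto intro!: bexI[of _ a] exI[of _ 0])
  next
    case False
    then obtain b c where b: "monomial b \<in> I" "a = b + c" "b \<noteq> a"
      using less.prems by (auto simp: minimal_generators_def monomial_dvd_iff)
    then have "exp_degree b < exp_degree a"
      by (auto simp: exp_degree_add exp_degree_eq_0_iff intro: gr0I)
    then obtain b' c' where "b' \<in> minimal_generators I" "b = b' + c'"
      using less.hyps b(1) by blast
    then show ?thesis using b(2) by (auto simp: add.assoc)
  qed
qed

end

section \<open>Artinian monomial ideals generated in degree d\<close>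

locale equigenerated = monomial_quotient I for I :: "('n::finite, 'k::field) mpoly set" +
  fixes d :: nat
  assumes degree_ge_2: "2 \<le> d"
    and not_mem_low: "exp_degree a < d \<Longrightarrow> monomial a \<notin> I"
    and power_mem: "monomial (Poly_Mapping.single v d) \<in> I"

text \<open>Some power of x_v lies in \<open>I\<close>. A minimal generator dividing it is again a
  power of x_v, and its degree is \<open>d\<close>.\<close>

lemma equigeneratedI:
  fixes I :: "('n::finite, 'k::field) mpoly set"
  assumes "artinian_monomial_ideal d I" "2 \<le> d"
  shows "equigenerated I d"
proof -
  interpret monomial_quotient I
    using assms by (simp add: artinian_monomial_ideal_def monomial_ideal_iff)
  have gen: "\<exists>b c. a = b + c \<and> exp_degree b = d \<and> monomial b \<in> I" if "monomial a \<in> I" for a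
    using mem_minimal_generator[OF that] assms(1)
    by (auto simp: artinian_monomial_ideal_def generated_in_degree_def minimal_generators_def)
  have low: "monomial a \<notin> I" if "exp_degree a < d" for a
    using gen[of a] that by (auto simp: exp_degree_add)
  show ?thesis
  proof unfold_locales
    fix v :: 'n
    have "monomial 0 \<notin> I" using low assms(2) by simp
    then obtain m where "monomial (Poly_Mapping.single v m) \<in> I"
      using artinian_imp_power_mem assms(1) unfolding artinian_monomial_ideal_def by blast
    then obtain b c where b: "Poly_Mapping.single v m = b + c" "exp_degree b = d" "monomial b \<in> I"
      using gen by blast
    have "lk b w = 0" if "w \<noteq> v" for w
      using arg_cong[OF b(1), of "\<lambda>a. lk a w"] that by (simp add: lookup_add lookup_single)
    then have "b = Poly_Mapping.single v (lk b v)"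
      by (intro poly_mapping_eqI) (auto simp: lookup_single when_def)
    then have "b = Poly_Mapping.single v d"
      using b(2) by (metis exp_degree_single)
    then show "monomial (Poly_Mapping.single v d) \<in> I" using b(3) by simp
  qed (use assms(2) low in auto)
qed

context equigenerated
begin

lemma proper: "monomial 0 \<notin> I"
  using not_mem_low[of 0] degree_ge_2 by simp

text \<open>Since \<open>I\<close> has no non-zero form of degree below \<open>d\<close>, a product
  L^i q of such a degree in \<open>I\<close> is zero, and L can be cancelled.\<close>

lemma mult_injective_low:
  assumes "j + i < d"
  shows "mult_injective I (ell I) i j"
proof (rule mult_injectiveI)
  fix q :: "('n, 'k) mpoly"
  assume q: "q \<in> homogeneous_part j" "sum_of_variables ^ i * q \<in> I"
  have "lk (sum_of_variables ^ i * q) a = 0" for a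
  proof (rule ccontr)
    assume "lk (sum_of_variables ^ i * q) a \<noteq> 0"
    then have "a \<in> Poly_Mapping.keys (sum_of_variables ^ i * q)" by (simp add: in_keys_iff)
    then have "monomial a \<in> I" "exp_degree a = j + i"
      using q(2) mem_iff[of "sum_of_variables ^ i * q"]
        homogeneous_sum_of_variables_power_mult[OF q(1), of i]
      by (auto simp: homogeneous_part_def)
    then show False using assms not_mem_low by simp
  qed
  then have "sum_of_variables ^ i * q = 0" by (intro poly_mapping_eqI) simp
  then show "q \<in> I" using sum_of_variables_power_mult_eq_0 zero_mem by blast
qed

lemma exponent_less:
  assumes "a \<in> std k"
  shows "lk a v < d"
proof (rule ccontr)
  assume "\<not> lk a v < d"
  then have "\<forall>w. lk (Poly_Mapping.single v d) w \<le> lk a w"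
    by (auto simp: lookup_single when_def)
  from exponents_le_add[OF this] have "monomial a \<in> I"
    using monomial_add_mem[OF power_mem] by metis
  with assms show False by (simp add: std_def)
qed

text \<open>The shadow of \<open>a\<close>. Shadows of standard monomials are standard, so their
  sizes bound the number of standard monomials one degree lower.\<close>

definition divisors :: "('n \<Rightarrow>\<^sub>0 nat) \<Rightarrow> ('n \<Rightarrow>\<^sub>0 nat) set" where
  "divisors a = (\<lambda>v. a - ev v) ` {v. lk a v > 0}"

lemma divisors_subset_std: "a \<in> std (Suc k) \<Longrightarrow> divisors a \<subseteq> std k"
  unfolding divisors_def using std_divide_variable by blast

lemma finite_divisors: "finite (divisors a)"
  by (simp add: divisors_def)

lemma card_divisors: "card (divisors a) = card {v. lk a v > 0}"
  unfolding divisors_def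
proof (rule card_image, rule inj_onI)
  fix v w assume "v \<in> {v. lk a v > 0}" "w \<in> {v. lk a v > 0}" "a - ev v = a - ev w"
  then have "ev v = ev w"
    using divide_variable[of a v] divide_variable[of a w] by (metis add_right_cancel mem_Collect_eq)
  then show "v = w" by (metis lookup_single_eq lookup_single_not_eq one_neq_zero)
qed

text \<open>With fewer than two variables \<open>a\<close> would be a pure power of degree at least
  \<open>d\<close>, hence in \<open>I\<close>.\<close>

lemma card_divisors_ge_2:
  assumes "a \<in> std k" "d \<le> k"
  shows "2 \<le> card (divisors a)"
proof (rule ccontr)
  assume "\<not> 2 \<le> card (divisors a)"
  then have card: "card {v. lk a v > 0} \<le> 1" by (simp add: card_divisors)
  have "exp_degree a > 0" using assms degree_ge_2 by (simp add: std_def)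
  then obtain v where v: "lk a v > 0" by (rule exists_positive_exponent)
  then have "{v. lk a v > 0} = {v}"
    using card by (auto simp: card_le_Suc0_iff_eq)
  then have "exp_degree a = lk a v"
    unfolding exp_degree_def by (subst sum.mono_neutral_right[of _ "{v}"]) auto
  then show False using assms exponent_less[OF assms(1), of v] by (simp add: std_def)
qed

text \<open>For \<open>d = 2\<close> all squares of variables are in \<open>I\<close>, so standard
  monomials are squarefree and the degree counts the variables.\<close>

lemma card_divisors_squarefree:
  assumes "a \<in> std k" "d = 2"
  shows "card (divisors a) = k"
proof -
  have "lk a v = (if lk a v > 0 then 1 else 0)" for v
    using exponent_less[OF assms(1), of v] assms(2) by auto
  then have "exp_degree a = (\<Sum>v\<in>UNIV. if lk a v > 0 then 1 else 0)"
    unfolding exp_degree_def by (intro sum.cong) auto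
  also have "\<dots> = (\<Sum>v | lk a v > 0. 1)"
    by (rule sum.mono_neutral_cong_right) auto
  finally show ?thesis
    using assms(1) by (simp add: card_divisors std_def)
qed

text \<open>A common divisor of codegree one must be the gcd, whose exponents are the
  minima.\<close>

lemma card_divisors_Int:
  assumes "a \<noteq> b"
  shows "card (divisors a \<inter> divisors b) \<le> 1"
proof -
  have "lk c u = min (lk a u) (lk b u)" if c: "c \<in> divisors a \<inter> divisors b" for c u
  proof -
    obtain v w where "lk a v > 0" "c = a - ev v" "lk b w > 0" "c = b - ev w"
      using c by (auto simp: divisors_def)
    then have vw: "a = ev v + c" "b = ev w + c" using divide_variable by metis+
    with assms have "v \<noteq> w" by auto
    with vw show ?thesis by (auto simp: lookup_add lookup_single when_def)
  qed
  then have "c = c'" if "c \<in> divisors a \<inter> divisors b" "c' \<in> divisors a \<inter> divisors b" for c c'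
    using that by (intro poly_mapping_eqI) simp
  then show ?thesis by (auto simp: card_le_Suc0_iff_eq finite_divisors)
qed

context
  assumes few: "card (std d) \<le> (if d = 2 then 3 else 2)"
begin

text \<open>Two standard monomials of degree d + 1 have shadows that share at most one element.
  Their union has at least 3 + 3 - 1 = 5 elements if d = 2, and at least 2 + 2 - 1 = 3 otherwise,
  which exceeds \<open>card (std d)\<close>.\<close>

lemma card_std_Suc: "card (std (Suc d)) \<le> 1"
proof (rule ccontr)
  assume "\<not> card (std (Suc d)) \<le> 1"
  then obtain a b where ab: "a \<in> std (Suc d)" "b \<in> std (Suc d)" "a \<noteq> b"
    by (auto simp: card_le_Suc0_iff_eq finite_std)
  have "card (divisors a \<union> divisors b) + 1 \<ge> card (divisors a) + card (divisors b)"
    using card_Un_Int[OF finite_divisors[of a] finite_divisors[of b]] card_divisors_Int[OF ab(3)]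
    by simp
  moreover have "card (divisors a \<union> divisors b) \<le> card (std d)"
    using ab by (intro card_mono finite_std Un_least divisors_subset_std)
  ultimately show False
    using few card_divisors_ge_2[OF ab(1)] card_divisors_ge_2[OF ab(2)]
      card_divisors_squarefree[OF ab(1)] card_divisors_squarefree[OF ab(2)]
    by (auto split: if_splits)
qed

text \<open>The shadow of a standard monomial of degree d + 2 would have two elements, but degree d
  + 1 has at most one.\<close>

lemma std_empty:
  assumes "d + 2 \<le> k"
  shows "std k = {}"
  using assms
proof (induction rule: dec_induct)
  case base
  have False if "a \<in> std (d + 2)" for a
  proof -
    have "divisors a \<subseteq> std (Suc d)" using that by (intro divisors_subset_std) simp
    then have "card (divisors a) \<le> card (std (Suc d))" by (intro card_mono finite_std)
    then show False using card_std_Suc card_divisors_ge_2[OF that] by simp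
  qed
  then show ?case by blast
next
  case (step k)
  have False if "a \<in> std (Suc k)" for a
  proof -
    obtain v where "lk a v > 0"
      using exists_positive_exponent[of a] \<open>a \<in> std (Suc k)\<close> by (auto simp: std_def)
    then show False using std_divide_variable[OF that] step by blast
  qed
  then show ?case by blast
qed

end

lemma std_2_eq_edge:
  assumes "d = 2" "a \<in> std 2" "lk a u > 0"
  obtains v where "v \<noteq> u" "a = ev u + ev v"
proof -
  have deg: "exp_degree a = 2" using assms(2) by (simp add: std_def)
  have deg1: "exp_degree (a - ev u) = 1"
    using exp_degree_divide_variable[OF assms(3)] deg by simp
  then obtain v where v: "lk (a - ev u) v > 0"
    using exists_positive_exponent[of "a - ev u"] by auto
  have "exp_degree (a - ev u - ev v) = 0"
    using exp_degree_divide_variable[OF v] deg1 by simp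
  then have "a - ev u = ev v"
    using divide_variable[OF v] by (simp add: exp_degree_eq_0_iff)
  then have a: "a = ev u + ev v"
    using divide_variable[OF assms(3)] by simp
  moreover have "v \<noteq> u"
    using exponent_less[OF assms(2), of u] assms(1) by (auto simp: a lookup_add)
  ultimately show ?thesis using that by blast
qed

end

lemma ev_eq_iff [simp]: "ev v = ev w \<longleftrightarrow> v = w"
  by (metis lookup_single_eq lookup_single_not_eq one_neq_zero)

lemma lookup_sum_of_variables_single:
  "lk (sum_of_variables :: ('n::finite, 'k::field) mpoly) (ev v) = 1"
proof -
  have "lk (sum_of_variables :: ('n, 'k) mpoly) (ev v) = (\<Sum>w\<in>UNIV. if w = v then 1 else 0)"
    unfolding sum_of_variables_def lookup_sum monomial_def
    by (rule sum.cong) (auto simp: lookup_single when_def simp del: One_nat_def)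
  then show ?thesis by simp
qed

text \<open>On edges (\<open>u\<close> \<noteq> \<open>w\<close>) this is the vertex-edge incidence
  matrix, the matrix of L from degree 1 to degree 2.\<close>

lemma lookup_sum_of_variables_mult_variable:
  "lk (sum_of_variables * monomial (ev v) :: ('n::finite, 'k::field) mpoly) (ev u + ev w) =
     (if v = u \<or> v = w then 1 else 0)"
proof -
  have "lk (ev u + ev w) v > 0 \<longleftrightarrow> v = u \<or> v = w"
    by (auto simp: lookup_add lookup_single when_def)
  moreover have "lk (sum_of_variables :: ('n, 'k) mpoly) (ev u + ev w - ev v) = 1" if "v = u \<or> v = w"
    using that lookup_sum_of_variables_single[of u, where 'k = 'k]
      lookup_sum_of_variables_single[of w, where 'k = 'k] by auto
  ultimately show ?thesis
    by (simp add: mult.commute[of sum_of_variables] lookup_variable_mult del: One_nat_def)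
qed

text \<open>
  For \<open>d = 2\<close> the standard monomials of degree 2 are the edges of a graph. Three edges either have
  a leaf, or form a triangle.
\<close>
lemma mult_surjective_three_edges:
  fixes I :: "('n::finite, 'k::field_char_0) mpoly set"
  assumes "equigenerated I 2" "card (monomial_quotient.std I 2) = 3"
  shows "mult_surjective I (ell I) 1 1"
proof -
  interpret equigenerated I 2 by fact
  let ?L = "sum_of_variables :: ('n, 'k) mpoly"
  let ?c = "\<lambda>x p. Poly_Mapping.single 0 x * p :: ('n, 'k) mpoly"
  have hom: "?c x (monomial (ev v)) \<in> homogeneous_part 1" for x v
    unfolding monomial_def by (intro homogeneous_const_mult homogeneous_single) simp
  have edge: "\<exists>v. v \<noteq> u \<and> a = ev u + ev v" if "a \<in> std 2" "lk a u > 0" for a u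
    by (rule std_2_eq_edge[OF refl that]) blast
  have "\<exists>q\<in>homogeneous_part 1. \<forall>a\<in>std 2. lk (?L * q) a = f a" for f
  proof (cases "\<exists>e\<in>std 2. \<exists>v. lk e v > 0 \<and> (\<forall>a\<in>std 2 - {e}. lk a v = 0)")
    case True
    then obtain e v where e: "e \<in> std 2" "lk e v > 0" "\<forall>a\<in>std 2 - {e}. lk a v = 0" by blast
    obtain q where q: "q \<in> homogeneous_part 1" "\<forall>a\<in>std 2 - {e}. lk (?L * q) a = f a"
    proof -
      have "card (std 2 - {e}) \<le> Suc 1" "\<forall>a\<in>std 2 - {e}. exp_degree a = 1 + 1"
        using e(1) assms(2) by (auto simp: std_def)
      from interpolate[OF _ this(2,1), of f] show ?thesis
        using that finite_std unfolding power_one_right by blast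
    qed
    \<comment> \<open>The two edges other than \<open>e\<close> are within reach of interpolation.
      Adding a multiple of the leaf variable x_v changes only the value at \<open>e\<close>.\<close>
    let ?q = "q + ?c (f e - lk (?L * q) e) (monomial (ev v))"
    have lookup: "lk (?L * ?q) a =
        lk (?L * q) a + (f e - lk (?L * q) e) * lk (?L * monomial (ev v)) a" for a
      by (simp add: distrib_left lookup_add mult.left_commute[of ?L] lookup_const_mult)
    obtain w where w: "e = ev v + ev w" using edge[OF e(1,2)] by blast
    have "lk (?L * monomial (ev v)) a = 0" if "a \<in> std 2 - {e}" for a
      using e(3) that by (simp add: mult.commute[of ?L] lookup_variable_mult del: One_nat_def)
    moreover have "lk (?L * monomial (ev v)) e = 1"
      unfolding w lookup_sum_of_variables_mult_variable by simp
    ultimately have "lk (?L * ?q) a = f a" if "a \<in> std 2" for a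
      using q(2) that unfolding lookup by (cases "a = e") auto
    moreover have "?q \<in> homogeneous_part 1" using q(1) hom by (rule homogeneous_add)
    ultimately show ?thesis by blast
  next
    case False
    \<comment> \<open>Without a leaf every end of an edge lies on a second edge. From the edge uv
      this yields edges uw and vx, and the second edge at w can only be vx, so x = w.\<close>
    then have no_leaf: "\<exists>a\<in>std 2. a \<noteq> e \<and> lk a v > 0" if "e \<in> std 2" "lk e v > 0" for e v
    proof -
      have "\<not> (\<forall>a\<in>std 2 - {e}. lk a v = 0)" using False that by blast
      then show ?thesis by auto
    qed
    have "std 2 \<noteq> {}" using assms(2) by auto
    then obtain a where a: "a \<in> std 2" by blast
    then have "exp_degree a > 0" by (simp add: std_def)
    then obtain u where u: "lk a u > 0" by (rule exists_positive_exponent)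
    obtain v where v: "v \<noteq> u" "a = ev u + ev v" using edge[OF a u] by blast
    have ev_pos: "lk (ev x + ev y) z > 0 \<longleftrightarrow> z = x \<or> z = y" for x y z :: 'n
      by (auto simp: lookup_add lookup_single when_def)
    obtain b where b: "b \<in> std 2" "b \<noteq> a" "lk b u > 0"
      using no_leaf[OF a u] by blast
    obtain w where w: "w \<noteq> u" "b = ev u + ev w" using edge[OF b(1,3)] by blast
    have vw: "v \<noteq> w" using b(2) v(2) w(2) by auto
    have "lk a v > 0" unfolding v(2) ev_pos by simp
    from no_leaf[OF a this] obtain c where c: "c \<in> std 2" "c \<noteq> a" "lk c v > 0"
      by blast
    obtain x where x: "x \<noteq> v" "c = ev v + ev x" using edge[OF c(1,3)] by blast
    have "c \<noteq> b" using c(3) w(2) v(1) vw ev_pos by auto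
    then have std: "std 2 = {a, b, c}"
      using assms(2) a b c by (intro card_seteq[symmetric] finite_std) auto
    have "lk b w > 0" unfolding w(2) ev_pos by simp
    from no_leaf[OF b(1) this] obtain b' where b': "b' \<in> std 2" "b' \<noteq> b" "lk b' w > 0"
      by blast
    then have "w = x" using std v w x vw ev_pos by auto
    then have c': "c = ev v + ev w" using x by simp
    \<comment> \<open>The weights of the three vertices solve the system in which the two ends of
      each edge add up to the prescribed value; its determinant is 2 up to sign.\<close>
    define q where "q = ?c ((f a + f b - f c) / 2) (monomial (ev u)) +
      ?c ((f a + f c - f b) / 2) (monomial (ev v)) + ?c ((f b + f c - f a) / 2) (monomial (ev w))"
    have "q \<in> homogeneous_part 1" unfolding q_def by (intro homogeneous_add hom)
    moreover have "lk (?L * q) y = f y" if "y \<in> std 2" for y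
    proof -
      have "lk (?L * q) y = (f a + f b - f c) / 2 * lk (?L * monomial (ev u)) y +
        (f a + f c - f b) / 2 * lk (?L * monomial (ev v)) y +
        (f b + f c - f a) / 2 * lk (?L * monomial (ev w)) y"
        by (simp add: q_def distrib_left lookup_add mult.left_commute[of ?L] lookup_const_mult)
      moreover have "y = a \<or> y = b \<or> y = c" using that std by blast
      ultimately show ?thesis
        using v(1) w(1) vw
        by (auto simp only: v(2) w(2) c' lookup_sum_of_variables_mult_variable)
          (auto simp: field_simps)
    qed
    ultimately show ?thesis by blast
  qed
  then show ?thesis
    by (intro mult_surjective_if_interpolates[OF monomial_quotient_axioms]) (simp add: numeral_2_eq_2)
qed

section \<open>Lower bounds for the Hilbert function in degree d\<close>

lemma card_std_ge_if_not_maximal_rank: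
  fixes I :: "('n::finite, 'k::field_char_0) mpoly set"
  assumes "equigenerated I d" "i \<le> d - 1" "\<not> maximal_rank I (ell I) i j"
  shows "card (monomial_quotient.std I d) \<ge> d - i + 2"
proof (rule ccontr)
  interpret equigenerated I d by fact
  assume "\<not> card (std d) \<ge> d - i + 2"
  \<comment> \<open>Missing the bound by one is exactly the interpolation condition for source
    degree d - i.\<close>
  then have "card (std (d - i + i)) \<le> Suc (d - i)"
    using assms(2) by simp
  then have "mult_surjective I (ell I) i (d - i)"
    by (rule mult_surjective_if_card_le[OF monomial_quotient_axioms])
  moreover have "\<not> j + i < d"
    using assms(3) mult_injective_low by (auto simp: maximal_rank_def)
  ultimately have "mult_surjective I (ell I) i j"
    using mult_surjective_mono[of i "d - i" j] by simp
  with assms(3) show False by (simp add: maximal_rank_def)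
qed

text \<open>The source is spanned by 1 and no coefficient of L^i vanishes, so a single standard
  monomial of degree \<open>i\<close> detects the scalar; if there is none, the target is
  zero.\<close>

lemma maximal_rank_degree_0:
  fixes I :: "('n::finite, 'k::field_char_0) mpoly set"
  assumes "monomial_quotient I"
  shows "maximal_rank I (ell I) i 0"
proof -
  interpret monomial_quotient I by fact
  show ?thesis
  proof (cases "std i = {}")
    case True
    then have "mult_surjective I (ell I) i 0"
      by (intro mult_surjective_if_card_le[OF monomial_quotient_axioms]) simp
    then show ?thesis by (simp add: maximal_rank_def)
  next
    case False
    then obtain a where a: "exp_degree a = i" "monomial a \<notin> I" by (auto simp: std_def)
    have "mult_injective I (ell I) i 0"
    proof (rule mult_injectiveI)
      fix q :: "('n, 'k) mpoly"
      assume q: "q \<in> homogeneous_part 0" "sum_of_variables ^ i * q \<in> I"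
      have q_eq: "q = Poly_Mapping.single 0 (lk q 0)"
        using q(1) by (intro poly_mapping_eqI)
          (auto simp: lookup_single when_def exp_degree_eq_0_iff intro!: homogeneous_lookup_eq_0)
      have "a \<notin> Poly_Mapping.keys (sum_of_variables ^ i * q)"
        using q(2) mem_iff[of "sum_of_variables ^ i * q"] a(2) by blast
      moreover have "lk (sum_of_variables ^ i * q) a = lk q 0 * lk (sum_of_variables ^ i) a"
        by (subst q_eq) (simp only: mult.commute[of "_ ^ _"] lookup_const_mult)
      ultimately have "lk q 0 = 0"
        using sum_of_variables_power_nonzero[OF a(1), where 'k = 'k] by (simp add: in_keys_iff)
      then show "q \<in> I" using q_eq zero_mem by simp
    qed
    then show ?thesis by (simp add: maximal_rank_def)
  qed
qed

lemma strong_lefschetz_if_few: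
  fixes I :: "('n::finite, 'k::field_char_0) mpoly set"
  assumes "equigenerated I d"
    and few: "card (monomial_quotient.std I d) \<le> (if d = 2 then 3 else 2)"
  shows "strong_lefschetz I"
proof -
  interpret equigenerated I d by fact
  have "maximal_rank I (ell I) i j" if "1 \<le> i" for i j
  proof -
    \<comment> \<open>For j >= 1 interpolation reaches two monomials, which suffices above degree
      \<open>d\<close>, where at most one is left. For j = 0 it reaches only one, while degree
      \<open>d\<close> may carry up to three.\<close>
    consider "j = 0" | "j + i < d" | "j \<ge> 1" "j + i = d" | "j \<ge> 1" "j + i = Suc d" | "d + 2 \<le> j + i"
      by linarith
    then show ?thesis
    proof cases
      case 1
      then show ?thesis using maximal_rank_degree_0[OF monomial_quotient_axioms] by simp
    next
      case 2
      then show ?thesis using mult_injective_low by (simp add: maximal_rank_def)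
    next
      case 3
      have "mult_surjective I (ell I) i j"
      proof (cases "card (std d) \<le> Suc j")
        case True
        then show ?thesis
          using 3 by (intro mult_surjective_if_card_le[OF monomial_quotient_axioms]) simp
      next
        case False
        \<comment> \<open>The only case beyond the reach of interpolation.\<close>
        then have "d = 2" "i = 1" "j = 1" "card (std 2) = 3"
          using few 3 that degree_ge_2 by (auto split: if_splits)
        then show ?thesis
          using mult_surjective_three_edges equigenerated_axioms by metis
      qed
      then show ?thesis by (simp add: maximal_rank_def)
    next
      case 4
      then show ?thesis
        using mult_surjective_if_card_le[OF monomial_quotient_axioms, of j i] card_std_Suc[OF few]
        by (simp add: maximal_rank_def)
    next
      case 5
      then show ?thesis
        using mult_surjective_if_card_le[OF monomial_quotient_axioms, of j i] std_empty[OF few]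
        by (simp add: maximal_rank_def)
    qed
  qed
  moreover have "ell I \<in> graded_piece I 1"
    unfolding ell_def graded_piece_def by (intro imageI homogeneous_sum_of_variables)
  ultimately show ?thesis unfolding strong_lefschetz_def by blast
qed

subsection \<open>Sharpness\<close>

definition ideal_avoiding :: "nat \<Rightarrow> ('n::finite \<Rightarrow>\<^sub>0 nat) set \<Rightarrow> ('n, 'k::field) mpoly set" where
  "ideal_avoiding d A = Idl\<^bsub>mpoly_ring\<^esub> (monomial ` {g. exp_degree g = d \<and> g \<notin> A})"

lemma monomial_ideal_avoiding: "monomial_ideal (ideal_avoiding d A)"
  unfolding monomial_ideal_def ideal_avoiding_def by blast

lemma monomial_mem_ideal_avoiding_iff:
  "monomial a \<in> (ideal_avoiding d A :: ('n::finite, 'k::field) mpoly set) \<longleftrightarrow>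
     (\<exists>g c. exp_degree g = d \<and> g \<notin> A \<and> a = g + c)"
  unfolding ideal_avoiding_def Idl_monomials by auto

lemma std_ideal_avoiding:
  assumes "\<forall>a\<in>A. exp_degree a = d"
  shows "monomial_quotient.std (ideal_avoiding d A :: ('n::finite, 'k::field) mpoly set) d = A"
proof -
  interpret monomial_quotient "ideal_avoiding d A :: ('n, 'k) mpoly set"
    using monomial_ideal_avoiding monomial_ideal_iff by blast
  have "(\<exists>g c. exp_degree g = d \<and> g \<notin> A \<and> a = g + c) \<longleftrightarrow> a \<notin> A" if a: "exp_degree a = d" for a
  proof
    assume "\<exists>g c. exp_degree g = d \<and> g \<notin> A \<and> a = g + c"
    then obtain g c where g: "exp_degree g = d" "g \<notin> A" "a = g + c" by blast
    then have "c = 0" using a by (simp add: exp_degree_add exp_degree_eq_0_iff)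
    then show "a \<notin> A" using g by simp
  next
    assume "a \<notin> A"
    then show "\<exists>g c. exp_degree g = d \<and> g \<notin> A \<and> a = g + c"
      using a by (intro exI[of _ a] exI[of _ 0]) simp
  qed
  then show ?thesis
    unfolding std_def monomial_mem_ideal_avoiding_iff using assms by blast
qed

text \<open>As \<open>A\<close> contains no pure power, every x_v^d is a generator, which bounds all
  exponents of monomials outside the ideal. A minimal generator is divisible by a generator of
  degree \<open>d\<close> and hence equal to it.\<close>

lemma artinian_monomial_ideal_avoiding:
  assumes "0 < d" "\<forall>v. Poly_Mapping.single v d \<notin> A"
  shows "artinian_monomial_ideal d (ideal_avoiding d A :: ('n::finite, 'k::field) mpoly set)"
proof -
  let ?I = "ideal_avoiding d A :: ('n, 'k) mpoly set"
  interpret monomial_quotient ?I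
    using monomial_ideal_avoiding monomial_ideal_iff by blast
  have "exp_degree a \<le> CARD('n) * d" if a: "monomial a \<notin> ?I" for a
  proof -
    have "lk a v \<le> d" for v
    proof (rule ccontr)
      assume "\<not> lk a v \<le> d"
      then have "\<forall>w. lk (Poly_Mapping.single v d) w \<le> lk a w"
        by (auto simp: lookup_single when_def)
      from exponents_le_add[OF this] have "monomial a \<in> ?I"
        unfolding monomial_mem_ideal_avoiding_iff using assms(2) exp_degree_single by metis
      with a show False by blast
    qed
    then show ?thesis
      unfolding exp_degree_def using sum_bounded_above[of UNIV "lk a" d] by simp
  qed
  then have "{a. monomial a \<notin> ?I} \<subseteq> (\<Union>k\<le>CARD('n) * d. {a. exp_degree a = k})" by blast
  then have "finite {a. monomial a \<notin> ?I}"
    by (rule finite_subset) (simp add: finite_exponents_of_degree)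
  moreover have "monomial 0 \<notin> ?I"
  proof
    assume "monomial 0 \<in> ?I"
    then obtain g c where g: "exp_degree g = d" "g \<notin> A" "0 = g + c"
      unfolding monomial_mem_ideal_avoiding_iff by blast
    then show False using assms(1) exp_degree_add[of g c] by simp
  qed
  ultimately have "artinian ?I" by (intro artinian_if_finite)
  moreover have "generated_in_degree d ?I"
    unfolding generated_in_degree_def
  proof
    fix a assume a: "a \<in> minimal_generators ?I"
    then obtain g c where g: "exp_degree g = d" "g \<notin> A" "a = g + c"
      unfolding minimal_generators_def monomial_mem_ideal_avoiding_iff by blast
    have "monomial g \<in> ?I"
      unfolding monomial_mem_ideal_avoiding_iff using g by (intro exI[of _ g] exI[of _ 0]) simp
    then have "g = a"
      using a g(3) unfolding minimal_generators_def monomial_dvd_iff by blast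
    then show "exp_degree a = d" using g(1) by simp
  qed
  ultimately show ?thesis
    by (simp add: artinian_monomial_ideal_def monomial_ideal_avoiding)
qed

section \<open>Linear functionals that vanish on multiples of powers of L\<close>

definition pairing :: "(('n::finite \<Rightarrow>\<^sub>0 nat) \<Rightarrow> 'k::field) \<Rightarrow> ('n, 'k) mpoly \<Rightarrow> 'k" where
  "pairing w p = (\<Sum>a\<in>Poly_Mapping.keys p. w a * lk p a)"

lemma pairing_superset:
  assumes "finite K" "Poly_Mapping.keys p \<subseteq> K"
  shows "pairing w p = (\<Sum>a\<in>K. w a * lk p a)"
  unfolding pairing_def using assms by (intro sum.mono_neutral_left) (auto simp: in_keys_iff)

lemma pairing_add: "pairing w (p + q) = pairing w p + pairing w q"
proof -
  let ?K = "Poly_Mapping.keys p \<union> Poly_Mapping.keys q"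
  have "pairing w (p + q) = (\<Sum>a\<in>?K. w a * lk (p + q) a)"
    by (rule pairing_superset) (use keys_add[of p q] in auto)
  also have "\<dots> = (\<Sum>a\<in>?K. w a * lk p a) + (\<Sum>a\<in>?K. w a * lk q a)"
    by (simp add: lookup_add distrib_left sum.distrib)
  also have "\<dots> = pairing w p + pairing w q"
    by (intro arg_cong2[of _ _ _ _ "(+)"] pairing_superset[symmetric]) auto
  finally show ?thesis .
qed

lemma pairing_single: "pairing w (Poly_Mapping.single a c) = w a * c"
  using pairing_superset[of "{a}" "Poly_Mapping.single a c" w] by simp

lemma pairing_sum: "pairing w (sum f X) = (\<Sum>x\<in>X. pairing w (f x))"
  by (induction X rule: infinite_finite_induct) (auto simp: pairing_add, auto simp: pairing_def)

text \<open>The transpose of multiplication by L, expressed on weights.\<close>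

lemma pairing_sum_of_variables_mult:
  "pairing w (sum_of_variables * p) = pairing (\<lambda>a. \<Sum>v\<in>UNIV. w (ev v + a)) p"
proof (induction p rule: poly_mapping_add_induct)
  case (single a c)
  show ?case
    unfolding sum_of_variables_def sum_distrib_right pairing_sum monomial_def mult_single
      pairing_single by simp
next
  case (add p q)
  then show ?case by (simp add: distrib_left pairing_add)
qed

text \<open>A functional supported on standard monomials depends only on the residue class. It
  vanishes on the image of L^i but not at the monomial \<open>b\<close>.\<close>

lemma not_mult_surjective_if_pairing:
  fixes I :: "('n::finite, 'k::field) mpoly set" and w :: "('n \<Rightarrow>\<^sub>0 nat) \<Rightarrow> 'k"
  assumes "monomial_quotient I"
    and zero: "\<And>q. q \<in> homogeneous_part j \<Longrightarrow> pairing w (sum_of_variables ^ i * q) = 0"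
    and supp: "\<And>a. exp_degree a = j + i \<Longrightarrow> w a \<noteq> 0 \<Longrightarrow> a \<in> monomial_quotient.std I (j + i)"
    and b: "exp_degree b = j + i" "w b \<noteq> 0"
  shows "\<not> mult_surjective I (ell I) i j"
proof
  interpret monomial_quotient I by fact
  assume surj: "mult_surjective I (ell I) i j"
  have "monomial b \<in> homogeneous_part (j + i)"
    unfolding monomial_def using b(1) by (rule homogeneous_single)
  then obtain q :: "('n, 'k) mpoly" where q: "q \<in> homogeneous_part j"
    "\<forall>a\<in>std (j + i). lk (sum_of_variables ^ i * q) a = lk (monomial b) a"
    using surj unfolding mult_surjective_iff by blast
  let ?p = "sum_of_variables ^ i * q" and ?K = "{a :: 'n \<Rightarrow>\<^sub>0 nat. exp_degree a = j + i}"
  have "pairing w ?p = (\<Sum>a\<in>?K. w a * lk ?p a)"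
    using homogeneous_sum_of_variables_power_mult[OF q(1), of i]
    by (intro pairing_superset finite_exponents_of_degree) (auto simp: homogeneous_part_def)
  also have "\<dots> = (\<Sum>a\<in>?K. w a * lk (monomial b) a)"
  proof (rule sum.cong)
    fix a assume "a \<in> ?K"
    then show "w a * lk ?p a = w a * lk (monomial b) a"
      using q(2) supp[of a] by (cases "w a = 0") auto
  qed simp
  also have "\<dots> = (\<Sum>a\<in>?K. if a = b then w b else 0)"
    by (intro sum.cong) (auto simp: monomial_def lookup_single when_def)
  also have "\<dots> = w b"
    using b(1) by (subst sum.delta[OF finite_exponents_of_degree]) simp
  finally show False using zero[OF q(1)] b(2) by simp
qed

text \<open>Choosing the support of the functional as the set of standard monomials makes its size
  the value of \<open>HF\<close>. Zero weight on pure powers puts them all into the ideal, which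
  makes it artinian.\<close>

lemma sharp_if_pairing:
  fixes w :: "('n::finite \<Rightarrow>\<^sub>0 nat) \<Rightarrow> 'k::field"
  assumes A_def: "A = {a. exp_degree a = j + i \<and> w a \<noteq> 0}"
    and "0 < j + i" "\<And>v. w (Poly_Mapping.single v (j + i)) = 0"
    and "\<And>q. q \<in> homogeneous_part j \<Longrightarrow> pairing w (sum_of_variables ^ i * q) = 0"
    and "A \<noteq> {}"
  shows "\<exists>I :: ('n, 'k) mpoly set. artinian_monomial_ideal (j + i) I \<and>
           \<not> mult_surjective I (ell I) i j \<and> HF I (j + i) = card A"
proof -
  let ?I = "ideal_avoiding (j + i) A :: ('n, 'k) mpoly set"
  interpret monomial_quotient ?I
    using monomial_ideal_avoiding monomial_ideal_iff by blast
  have std: "std (j + i) = A"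
    by (rule std_ideal_avoiding) (simp add: A_def)
  have "artinian_monomial_ideal (j + i) ?I"
    using assms by (intro artinian_monomial_ideal_avoiding) auto
  moreover obtain b where b: "b \<in> A" using \<open>A \<noteq> {}\<close> by blast
  then have "\<not> mult_surjective ?I (ell ?I) i j"
  proof (intro not_mult_surjective_if_pairing[OF monomial_quotient_axioms])
    show "pairing w (sum_of_variables ^ i * q) = 0" if "q \<in> homogeneous_part j" for q
      using that by (rule assms(4))
    show "a \<in> std (j + i)" if "exp_degree a = j + i" "w a \<noteq> 0" for a
      using that unfolding std by (simp add: A_def)
    show "exp_degree b = j + i" "w b \<noteq> 0" using b by (simp_all add: A_def)
  qed
  moreover have "monomial 0 \<notin> ?I"
    using b std monomial_add_mem[of 0 b] by (auto simp: std_def)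
  then have "HF ?I (j + i) = card A" by (simp add: HF_eq_card_std std)
  ultimately show ?thesis by blast
qed

text \<open>
  The coefficient of \<open>z\<^sup>s\<close> after the substitution \<open>x = 1\<close>, \<open>y = -1\<close> and all variables other than
  \<open>x, y, z\<close> equal to \<open>0\<close>; this substitution sends the sum of the variables to \<open>z\<close>.
\<close>
definition slice :: "'n \<Rightarrow> 'n \<Rightarrow> 'n \<Rightarrow> nat \<Rightarrow> ('n::finite \<Rightarrow>\<^sub>0 nat) \<Rightarrow> 'k::field" where
  "slice x y z s a =
     (if (\<forall>v. v \<notin> {x, y, z} \<longrightarrow> lk a v = 0) \<and> lk a z = s then (- 1) ^ lk a y else 0)"

context
  fixes x y z :: "'n::finite"
  assumes distinct: "x \<noteq> y" "x \<noteq> z" "y \<noteq> z"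
begin

text \<open>Infinitesimal form of L becoming z: the shifts by x and y cancel through the sign, the
  shift by z lowers the index, and any other variable leaves the support.\<close>

lemma sum_slice:
  "(\<Sum>v\<in>UNIV. slice x y z s (ev v + a)) =
     ((case s of 0 \<Rightarrow> 0 | Suc s' \<Rightarrow> slice x y z s' a) :: 'k::field)"
proof -
  define S where "S \<longleftrightarrow> (\<forall>v. v \<notin> {x, y, z} \<longrightarrow> lk a v = 0)"
  have slice: "slice x y z r a = (if S \<and> lk a z = r then (- 1) ^ lk a y else 0 :: 'k)" for r
    by (simp only: slice_def S_def)
  have slice_add: "slice x y z s (ev u + a) =
      (if S \<and> lk (ev u + a) z = s then (- 1) ^ lk (ev u + a) y else 0 :: 'k)"
    if "u \<in> {x, y, z}" for u
  proof -
    have "lk (ev u + a) v = lk a v" if "v \<notin> {x, y, z}" for v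
    proof -
      have "u \<noteq> v" using \<open>u \<in> {x, y, z}\<close> that by blast
      then show ?thesis by (simp add: lookup_add lookup_single)
    qed
    then have "(\<forall>v. v \<notin> {x, y, z} \<longrightarrow> lk (ev u + a) v = 0) \<longleftrightarrow> S"
      unfolding S_def by metis
    then show ?thesis by (simp only: slice_def)
  qed
  have "(\<Sum>v\<in>UNIV. slice x y z s (ev v + a)) =
      (\<Sum>v\<in>{x, y, z}. slice x y z s (ev v + a) :: 'k)"
    by (rule sum.mono_neutral_right) (auto simp: slice_def lookup_add)
  also have "\<dots> = slice x y z s (ev x + a) + slice x y z s (ev y + a) + slice x y z s (ev z + a)"
    using distinct by (simp add: add.assoc)
  also have "slice x y z s (ev x + a) = (slice x y z s a :: 'k)"
    using distinct slice_add[of x] by (simp add: slice lookup_add lookup_single)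
  also have "slice x y z s (ev y + a) = (- slice x y z s a :: 'k)"
    using distinct slice_add[of y] by (simp add: slice lookup_add lookup_single)
  also have "slice x y z s (ev z + a) = ((case s of 0 \<Rightarrow> 0 | Suc s' \<Rightarrow> slice x y z s' a) :: 'k)"
    using distinct slice_add[of z] by (simp add: slice lookup_add lookup_single split: nat.split)
  finally show ?thesis by simp
qed

text \<open>After the substitution the product is divisible by z^i, so its coefficients below z^i
  vanish. Each factor L removed lowers \<open>s\<close> by one, until the weight becomes
  zero.\<close>

lemma pairing_slice_eq_0:
  "s < i \<Longrightarrow> pairing (slice x y z s) (sum_of_variables ^ i * q :: ('n, 'k::field) mpoly) = 0"
proof (induction i arbitrary: s)
  case (Suc i)
  have "pairing (slice x y z s) (sum_of_variables ^ Suc i * q) =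
      pairing (\<lambda>a. case s of 0 \<Rightarrow> 0 | Suc s' \<Rightarrow> slice x y z s' a) (sum_of_variables ^ i * q)"
    by (simp only: power_Suc mult.assoc pairing_sum_of_variables_mult sum_slice)
  also have "\<dots> = 0"
    using Suc by (cases s) (simp_all add: pairing_def)
  finally show ?case .
qed simp

lemma card_slice:
  "card {a. exp_degree a = m + s \<and> slice x y z s a \<noteq> (0 :: 'k::field)} = Suc m"
proof -
  let ?f = "\<lambda>p. Poly_Mapping.single x p + Poly_Mapping.single y (m - p) + Poly_Mapping.single z s"
  have "{a. exp_degree a = m + s \<and> slice x y z s a \<noteq> (0 :: 'k)} = ?f ` {..m}" (is "?A = _")
  proof (intro equalityI subsetI)
    fix a assume "a \<in> ?A"
    then have a: "exp_degree a = m + s" "\<And>v. v \<notin> {x, y, z} \<Longrightarrow> lk a v = 0" "lk a z = s"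
      by (auto simp: slice_def split: if_splits)
    have "exp_degree a = (\<Sum>v\<in>{x, y, z}. lk a v)"
      unfolding exp_degree_def using a(2) by (intro sum.mono_neutral_right) auto
    then have "lk a x + lk a y = m" using a distinct by simp
    then have "a = ?f (lk a x)"
      using a distinct by (intro poly_mapping_eqI) (auto simp: lookup_add lookup_single when_def)
    then show "a \<in> ?f ` {..m}" using \<open>lk a x + lk a y = m\<close> by (intro image_eqI[of _ _ "lk a x"]) auto
  next
    fix a assume "a \<in> ?f ` {..m}"
    then show "a \<in> ?A"
      using distinct
      by (auto simp: slice_def exp_degree_add lookup_add lookup_single when_def split: if_splits)
  qed
  moreover have "inj_on ?f {..m}"
  proof (rule inj_onI)
    fix p q assume "?f p = ?f q"
    from arg_cong[OF this, of "\<lambda>a. lk a x"] show "p = q"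
      using distinct by (simp add: lookup_add lookup_single when_def)
  qed
  ultimately show ?thesis by (simp add: card_image)
qed

lemma sharp_slice:
  assumes "2 \<le> i" "i \<le> d - 1"
  shows "\<exists>I :: ('n, 'k::field) mpoly set. artinian_monomial_ideal d I \<and>
           \<not> mult_surjective I (ell I) i (d - i) \<and> HF I d = d - i + 2"
proof -
  \<comment> \<open>With z^(i-1) split off, the exponents of x and y add up to d - i + 1, which
    leaves d - i + 2 monomials.\<close>
  have d: "d - i + i = d" "d = (d - i + 1) + (i - 1)" using assms by auto
  have card: "card {a. exp_degree a = d - i + i \<and> slice x y z (i - 1) a \<noteq> (0 :: 'k)} = d - i + 2"
    using card_slice[of "d - i + 1" "i - 1", where 'k = 'k] unfolding d(1) d(2)[symmetric] by simp
  then have "{a. exp_degree a = d - i + i \<and> slice x y z (i - 1) a \<noteq> (0 :: 'k)} \<noteq> {}"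
    by (metis card.empty add_2_eq_Suc' nat.distinct(1))
  moreover have "slice x y z (i - 1) (Poly_Mapping.single v (d - i + i)) = (0 :: 'k)" for v
    using assms by (auto simp: slice_def lookup_single when_def)
  moreover have "pairing (slice x y z (i - 1)) (sum_of_variables ^ i * q :: ('n, 'k) mpoly) = 0" for q
    using assms by (intro pairing_slice_eq_0) simp
  moreover have "0 < d - i + i" using assms by simp
  ultimately show ?thesis
    using sharp_if_pairing[OF refl, of "d - i" i "slice x y z (i - 1) :: _ \<Rightarrow> 'k", unfolded card]
    unfolding d(1) by blast
qed

end

text \<open>
  For \<open>d = 2\<close> the extremal graph is the 4-cycle with edges the monomials of
  \<open>(x\<^sub>u - x\<^sub>u\<^sub>') (x\<^sub>v - x\<^sub>v\<^sub>')\<close>.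
\<close>
lemma sharp_4_cycle:
  fixes u u' v v' :: "'n::finite"
  assumes distinct: "distinct [u, u', v, v']"
  shows "\<exists>I :: ('n, 'k::field_char_0) mpoly set. artinian_monomial_ideal 2 I \<and>
           \<not> mult_surjective I (ell I) 1 1 \<and> HF I 2 = 4"
proof -
  \<comment> \<open>On quadrics \<open>w\<close> is the operator (d_u - d_u') (d_v - d_v') in
    partial derivatives; each factor annihilates L.\<close>
  define s t :: "('n \<Rightarrow>\<^sub>0 nat) \<Rightarrow> 'k" where
    "s a = of_nat (lk a u) - of_nat (lk a u')" and "t a = of_nat (lk a v) - of_nat (lk a v')" for a
  define w where "w a = s a * t a" for a
  let ?A = "{a. exp_degree a = 1 + 1 \<and> w a \<noteq> 0}"
  have st_add: "s (a + b) = s a + s b" "t (a + b) = t a + t b" for a b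
    by (simp_all add: s_def t_def lookup_add)
  have w_single: "w (Poly_Mapping.single x m) = 0" for x m
    using distinct by (auto simp: w_def s_def t_def lookup_single when_def)
  have "(\<Sum>x\<in>UNIV. of_nat (lk (ev x) y)) = (1 :: 'k)" for y :: 'n
  proof -
    have "(\<Sum>x\<in>UNIV. of_nat (lk (ev x) y)) = (\<Sum>x\<in>UNIV. if x = y then 1 else 0 :: 'k)"
      by (rule sum.cong) (auto simp: lookup_single)
    then show ?thesis by simp
  qed
  then have sum_s: "(\<Sum>x\<in>UNIV. s (ev x)) = 0" and sum_t: "(\<Sum>x\<in>UNIV. t (ev x)) = 0"
    unfolding s_def t_def sum_subtractf by simp_all
  have "pairing w (sum_of_variables ^ 1 * q) = 0" if q: "q \<in> homogeneous_part 1" for q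
  proof -
    have "(\<Sum>x\<in>UNIV. w (ev x + a)) = 0" if "a \<in> Poly_Mapping.keys q" for a
    proof -
      have deg: "exp_degree a = 1" using q that by (auto simp: homogeneous_part_def)
      then obtain y where y: "lk a y > 0" using exists_positive_exponent[of a] by auto
      then have "exp_degree (a - ev y) = 0" using exp_degree_divide_variable[OF y] deg by simp
      then have "a = ev y" using divide_variable[OF y] by (simp add: exp_degree_eq_0_iff)
      then have wa: "w a = 0" using w_single by simp
      \<comment> \<open>The product rule; the two pure terms drop out because \<open>w\<close>
        vanishes on single variables, and the cross terms sum to zero since the sums of
        \<open>s\<close> and of \<open>t\<close> over all variables are zero.\<close>
      have "w (ev x + a) = s (ev x) * t a + s a * t (ev x)" for x
      proof -
        have "w (ev x + a) = s (ev x) * t a + s a * t (ev x) + w a + w (ev x)"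
          by (simp add: w_def st_add algebra_simps)
        then show ?thesis using wa w_single by simp
      qed
      then have "(\<Sum>x\<in>UNIV. w (ev x + a)) = (\<Sum>x\<in>UNIV. s (ev x)) * t a + s a * (\<Sum>x\<in>UNIV. t (ev x))"
        by (simp add: sum.distrib sum_distrib_left sum_distrib_right)
      then show ?thesis unfolding sum_s sum_t by simp
    qed
    then show ?thesis
      unfolding power_one_right pairing_sum_of_variables_mult by (simp add: pairing_def)
  qed
  moreover have card: "card ?A = 4"
  proof -
    let ?f = "\<lambda>(x, y). ev x + ev y" and ?E = "{u, u'} \<times> {v, v'}"
    have "?A = ?f ` ?E"
    proof (intro equalityI subsetI)
      fix a assume a: "a \<in> ?A"
      then have "lk a u > 0 \<or> lk a u' > 0" "lk a v > 0 \<or> lk a v' > 0"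
        by (auto simp: w_def s_def t_def intro: gr0I)
      then obtain x y where xy: "(x, y) \<in> ?E" "lk a x > 0" "lk a y > 0" by blast
      then have "x \<noteq> y" using distinct by auto
      with xy have "\<forall>c. lk (ev x + ev y) c \<le> lk a c"
        by (auto simp: lookup_add lookup_single when_def)
      then have "ev x + ev y = a"
        using a by (intro eq_if_exponents_le) (auto simp: exp_degree_add)
      then show "a \<in> ?f ` ?E" using xy(1) by (intro image_eqI[of _ _ "(x, y)"]) auto
    next
      fix a assume "a \<in> ?f ` ?E"
      then show "a \<in> ?A"
        using distinct
        by (auto simp: exp_degree_add w_def s_def t_def lookup_add lookup_single when_def)
    qed
    moreover have "inj_on ?f ?E"
    proof (rule inj_onI, clarify)
      fix x y x' y'
      assume xy: "x \<in> {u, u'}" "y \<in> {v, v'}" "x' \<in> {u, u'}" "y' \<in> {v, v'}"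
        and eq: "ev x + ev y = ev x' + ev y'"
      have "x = x'"
        using arg_cong[OF eq, of "\<lambda>a. lk a x"] xy distinct
        by (auto simp: lookup_add lookup_single when_def split: if_splits)
      then show "x = x' \<and> y = y'" using eq ev_eq_iff[of y y'] by simp
    qed
    ultimately have "card ?A = card ?E" by (simp only: card_image)
    also have "\<dots> = 4" using distinct by (simp add: card_cartesian_product)
    finally show ?thesis .
  qed
  moreover from card have "?A \<noteq> {}" by (metis card.empty zero_neq_numeral)
  ultimately show ?thesis
    using sharp_if_pairing[OF refl, of 1 1 w] w_single by (simp add: numeral_2_eq_2)
qed

theorem theorem2:
  fixes d :: nat
  assumes n: "CARD('n::finite) \<ge> 3" and d: "d \<ge> 2"
  shows
    "(\<forall>I :: ('n, 'k::field_char_0) mpoly set.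
        artinian_monomial_ideal d I \<and> \<not> strong_lefschetz I \<longrightarrow>
        HF I d \<ge> (if d = 2 then 4 else 3))
     \<and>
     ((CARD('n), d) \<noteq> (3, 2) \<longrightarrow>
       (\<exists>I :: ('n, 'k) mpoly set.
          artinian_monomial_ideal d I \<and>
          \<not> mult_surjective I (ell I) (d - 1) 1 \<and>
          HF I d = (if d = 2 then 4 else 3)))
     \<and>
     (\<forall>i. 1 \<le> i \<and> i \<le> d - 1 \<longrightarrow>
       (\<forall>I :: ('n, 'k) mpoly set.
          artinian_monomial_ideal d I \<and> (\<exists>j. \<not> maximal_rank I (ell I) i j) \<longrightarrow>
          HF I d \<ge> d - i + 2))
     \<and>
     (\<forall>i. 2 \<le> i \<and> i \<le> d - 1 \<longrightarrow>
       (\<exists>I :: ('n, 'k) mpoly set.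
          artinian_monomial_ideal d I \<and>
          \<not> mult_surjective I (ell I) i (d - i) \<and>
          HF I d = d - i + 2))"
proof (intro conjI allI impI, goal_cases)
  case (1 I)
  then interpret equigenerated I d using d by (intro equigeneratedI) auto
  have "\<not> card (std d) \<le> (if d = 2 then 3 else 2)"
    using 1 strong_lefschetz_if_few[OF equigenerated_axioms] by blast
  then show ?case by (auto simp: HF_eq_card_std[OF proper] split: if_splits)
next
  case 2
  show ?case
  \<comment> \<open>Excluding (3,2) supplies the four vertices of the cycle when d = 2. For d >= 3
    the slice with i = d - 1 applies, and d - i + 2 = 3.\<close>
  proof (cases "d = 2")
    case True
    then have "4 \<le> CARD('n)" using 2 n by simp
    then obtain T :: "'n set" where "card T = Suc 3"
      using obtain_subset_with_card_n[of 4 "UNIV :: 'n set"] by auto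
    then obtain u T' where T: "T = insert u T'" "u \<notin> T'" "card T' = 3"
      by (auto simp only: card_Suc_eq)
    then obtain u' v v' where "T' = {u', v, v'}" "u' \<noteq> v" "u' \<noteq> v'" "v \<noteq> v'"
      by (auto simp: card_3_iff)
    with T have "distinct [u, u', v, v']" by auto
    from sharp_4_cycle[OF this, where 'k = 'k] True show ?thesis by simp
  next
    case False
    obtain T :: "'n set" where "card T = 3"
      using n obtain_subset_with_card_n by blast
    then obtain x y z :: 'n where "x \<noteq> y" "x \<noteq> z" "y \<noteq> z"
      by (auto simp: card_3_iff)
    from sharp_slice[OF this, of "d - 1" d, where 'k = 'k] False d show ?thesis
      by (simp add: numeral_3_eq_3)
  qed
next
  case (3 i I)
  then interpret equigenerated I d using d by (intro equigeneratedI) auto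
  obtain j where "\<not> maximal_rank I (ell I) i j" using 3 by blast
  with 3 show ?case
    using card_std_ge_if_not_maximal_rank[OF equigenerated_axioms] HF_eq_card_std[OF proper] by simp
next
  case (4 i)
  obtain T :: "'n set" where "card T = 3"
    using n obtain_subset_with_card_n by blast
  then obtain x y z :: 'n where "x \<noteq> y" "x \<noteq> z" "y \<noteq> z"
    by (auto simp: card_3_iff)
  from sharp_slice[OF this, of i d] 4 show ?case by blast
qed

end
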